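(* Let $a,b,c,d$ be complex numbers with $d\neq 0$ and let $|q|<1$. Define the continued fraction \[ H_{1}(a,b,c,d,q):= \cfrac{1}{1+\cfrac{-abq+c}{(a+b)q+d+\cfrac{-abq^3+cq}{(a+b)q^2+d+\cdots}}}, \] i.e. $H_1=\mathrm{K}_{n=1}^{\infty}\alpha_n/\beta_n$ with $\alpha_1=\beta_1=1$ and, for $n\ge 0$, $\alpha_{n+2}=-abq^{2n+1}+cq^n$, $\beta_{n+2}=(a+b)q^{n+1}+d$. Let $C_N$ and $D_N$ denote its $N$-th numerator and denominator convergents. (i) For $N\ge1$, \[ C_{N}= d^{N-1}\sum_{j,l,n\geq 0}a^{j}b^{n-j-l}c^{l} d^{-n-l}q^{n(n+1)/2+l(l-1)/2} \begin{bmatrix} N-1-n+j\\ j \end{bmatrix} \begin{bmatrix} N-1-j-l\\ n-j-l \end{bmatrix} \begin{bmatrix} N-1-n\\ l \end{bmatrix}, \] and for $N\geq 2$, \[ D_{N}=C_{N}+\Big(\frac{c}{bq}-a\Big)\sum_{j,l,n \geq 0}a^{j}b^{n+1-j-l}c^{l} d^{N-2-n-l} q^{(n+1)(n+2)/2+l(l-1)/2} \begin{bmatrix} N-2-n+j\\ j \end{bmatrix} \begin{bmatrix} N-2-j-l\\ n-j-l \end{bmatrix} \begin{bmatrix} N-2-n\\ l \end{bmatrix}. \] (ii) $H_{1}(a,b,c,d,q)$ converges and \[ \frac{1}{H_{1}(a,b,c,d,q)}-1= \frac{c-abq}{(d+aq)q}\cdot \frac{\displaystyle\sum_{j =0}^{\infty}\frac{(b/d)^{j}(-c/(bd);q)_{j}\,q^{(j+1)(j+2)/2}}{(q;q)_{j}(-aq^2/d;q)_{j}}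 } {\displaystyle\sum_{j =0}^{\infty}\frac{(b/d)^{j}(-c/(bd);q)_{j}\,q^{j(j+1)/2}}{(q;q)_{j}(-aq/d;q)_{j}} }. \] (iii) If $d=1$, then the numerators and denominators converge separately and \[ C_{\infty}:=\lim_{N \to \infty} C_{N} =(-aq;q)_{\infty} \sum_{j=0}^{\infty} \frac{ q^{j(j+1)/2}b^{j}(-c/b;q)_{j}}{(q;q)_{j}(-aq;q)_{j}}, \] \[ \lim_{N \to \infty} D_{N} = C_{\infty}+\Big(\frac{c}{q}-ab\Big)(-aq;q)_{\infty} \sum_{j=0}^{\infty} \frac{ q^{(j+1)(j+2)/2}b^{j}(-c/b;q)_{j}}{(q;q)_{j}(-aq;q)_{j+1}}. \]
   Context: For a continued fraction $\beta_0+\mathrm{K}_{n=1}^{\infty}\alpha_n/\beta_n$ (here $\beta_0=0$), the numerator and denominator convergents are defined by $A_{-1}=1$, $A_0=\beta_0$, $B_{-1}=0$, $B_0=1$, $A_N=\beta_NA_{N-1}+\alpha_NA_{N-2}$, $B_N=\beta_NB_{N-1}+\alpha_NB_{N-2}$ for $N\ge1$; convergence means $A_N/B_N$ converges. Notation: $(x;q)_0=1$, $(x;q)_n=\prod_{k=0}^{n-1}(1-xq^k)$, $(x;q)_\infty=\prod_{k\ge0}(1-xq^k)$. The Gaussian polynomial $\begin{bmatrix} n\\ m\end{bmatrix}=\frac{(q;q)_n}{(q;q)_m(q;q)_{n-m}}$ if $0\le m\le n$ and $0$ otherwise. Combinations such as $(b/d)^j(-c/(bd);q)_j$ and $b^j(-c/b;q)_j$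 are understood as the polynomials $\prod_{k=0}^{j-1}(b/d+cq^k/d^2)$ and $\prod_{k=0}^{j-1}(b+cq^k)$ respectively (so they make sense when $b=0$).
   Formalization: In (ii), convergence is in the Riemann sphere and assumes that C_N, D_N are not both 0 for infinitely many N (it fails for a=c=0, b=-d/q); formulas dividing by q, by (-aq/d;q)_j or by the lower series assume these are nonzero. *)

theory Defs
  imports "HOL-Analysis.Analysis"
begin

text \<open>Convergents of \<open>\<beta> 0 + K (\<alpha> n / \<beta> n)\<close>. The initial values
  \<open>A\<^bsub>-1\<^esub> = 1\<close> and \<open>B\<^bsub>-1\<^esub> = 0\<close> are substituted into the equations for index 1;
  \<open>\<alpha> 0\<close> is never used.\<close>

fun cf_num :: "(nat \<Rightarrow> complex) \<Rightarrow> (nat \<Rightarrow> complex) \<Rightarrow> nat \<Rightarrow> complex" where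
  "cf_num \<alpha> \<beta> 0 = \<beta> 0"
| "cf_num \<alpha> \<beta> (Suc 0) = \<beta> 1 * \<beta> 0 + \<alpha> 1 * 1"
| "cf_num \<alpha> \<beta> (Suc (Suc N)) =
     \<beta> (Suc (Suc N)) * cf_num \<alpha> \<beta> (Suc N) + \<alpha> (Suc (Suc N)) * cf_num \<alpha> \<beta> N"

fun cf_den :: "(nat \<Rightarrow> complex) \<Rightarrow> (nat \<Rightarrow> complex) \<Rightarrow> nat \<Rightarrow> complex" where
  "cf_den \<alpha> \<beta> 0 = 1"
| "cf_den \<alpha> \<beta> (Suc 0) = \<beta> 1 * 1 + \<alpha> 1 * 0"
| "cf_den \<alpha> \<beta> (Suc (Suc N)) =
     \<beta> (Suc (Suc N)) * cf_den \<alpha> \<beta> (Suc N) + \<alpha> (Suc (Suc N)) * cf_den \<alpha> \<beta> N"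

text \<open>Convergence of \<open>A\<^sub>N / B\<^sub>N\<close> in the Riemann sphere, with \<open>None\<close> as the point at infinity.
  A sequence of convergents that is \<open>0 / 0\<close> infinitely often converges to nothing.\<close>

definition cf_converges_to ::
    "(nat \<Rightarrow> complex) \<Rightarrow> (nat \<Rightarrow> complex) \<Rightarrow> complex option \<Rightarrow> bool" where
  "cf_converges_to \<alpha> \<beta> h \<longleftrightarrow>
     (case h of
        Some v \<Rightarrow> (\<forall>\<^sub>F N in sequentially. cf_den \<alpha> \<beta> N \<noteq> 0) \<and>
                  (\<lambda>N. cf_num \<alpha> \<beta> N / cf_den \<alpha> \<beta> N) \<longlonglongrightarrow> v
      | None \<Rightarrow> (\<forall>\<^sub>F N in sequentially. cf_num \<alpha> \<beta> N \<noteq> 0) \<and>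
                (\<lambda>N. cf_den \<alpha> \<beta> N / cf_num \<alpha> \<beta> N) \<longlonglongrightarrow> 0)"

definition sphere_inverse :: "complex option \<Rightarrow> complex option" where
  "sphere_inverse h =
     (case h of None \<Rightarrow> Some 0 | Some v \<Rightarrow> if v = 0 then None else Some (1 / v))"

definition qpoch :: "complex \<Rightarrow> complex \<Rightarrow> nat \<Rightarrow> complex" where
  "qpoch x q n = (\<Prod>k<n. 1 - x * q ^ k)"

definition qpoch_inf :: "complex \<Rightarrow> complex \<Rightarrow> complex" where
  "qpoch_inf x q = (\<Prod>k. 1 - x * q ^ k)"

text \<open>The polynomial meant by \<open>x\<^sup>n (-y/x; q)\<^sub>n\<close>, which also makes sense for \<open>x = 0\<close>.\<close>

definition qpoch_hom :: "complex \<Rightarrow> complex \<Rightarrow> complex \<Rightarrow> nat \<Rightarrow> complex" where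
  "qpoch_hom x y q n = (\<Prod>k<n. x + y * q ^ k)"

text \<open>Integer arguments, so that differences of indices do not get truncated at 0.\<close>

definition gauss_binom :: "complex \<Rightarrow> int \<Rightarrow> int \<Rightarrow> complex" where
  "gauss_binom q n m =
     (if 0 \<le> m \<and> m \<le> n
      then qpoch q q (nat n) / (qpoch q q (nat m) * qpoch q q (nat (n - m)))
      else 0)"

definition H1_alpha :: "complex \<Rightarrow> complex \<Rightarrow> complex \<Rightarrow> complex \<Rightarrow> nat \<Rightarrow> complex" where
  "H1_alpha a b c q n =
     (if n \<le> 1 then 1 else - a * b * q ^ (2 * (n - 2) + 1) + c * q ^ (n - 2))"

definition H1_beta :: "complex \<Rightarrow> complex \<Rightarrow> complex \<Rightarrow> complex \<Rightarrow> nat \<Rightarrow> complex" where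
  "H1_beta a b d q n =
     (if n = 0 then 0 else if n = 1 then 1 else (a + b) * q ^ (n - 1) + d)"

definition H1_C ::
    "complex \<Rightarrow> complex \<Rightarrow> complex \<Rightarrow> complex \<Rightarrow> complex \<Rightarrow> nat \<Rightarrow> complex" where
  "H1_C a b c d q = cf_num (H1_alpha a b c q) (H1_beta a b d q)"

definition H1_D ::
    "complex \<Rightarrow> complex \<Rightarrow> complex \<Rightarrow> complex \<Rightarrow> complex \<Rightarrow> nat \<Rightarrow> complex" where
  "H1_D a b c d q = cf_den (H1_alpha a b c q) (H1_beta a b d q)"

definition H1_converges_to ::
    "complex \<Rightarrow> complex \<Rightarrow> complex \<Rightarrow> complex \<Rightarrow> complex \<Rightarrow> complex option \<Rightarrow> bool" where
  "H1_converges_to a b c d q h \<longleftrightarrow>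
     cf_converges_to (H1_alpha a b c q) (H1_beta a b d q) h"

end

theory Submission
  imports Defs "HOL-Computational_Algebra.Formal_Power_Series"
begin

text \<open>The closed form of the numerators is read off from a power series solution of their recurrence,
  in which the Gaussian polynomials are the coefficients of finite \<open>q\<close>-products. The denominators
  differ from the numerators by \<open>c - abq\<close> times the numerators at \<open>aq, bq, cq\<close>.

  For the limits, divide the \<open>n\<close>-th convergents by \<open>d\<^sup>n\<close>, so that they solve
  \<open>X\<^bsub>n+2\<^esub> = \<beta>\<^sub>n X\<^bsub>n+1\<^esub> + \<alpha>\<^sub>n X\<^sub>n\<close> with \<open>\<beta>\<^sub>n \<rightarrow> 1\<close> and \<open>\<alpha>\<^sub>n \<rightarrow> 0\<close>. The \<open>q\<close>-series of the theorem, taken at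
  \<open>aq\<^sup>n, bq\<^sup>n, cq\<^sup>n\<close>, gives a solution \<open>T\<^sub>n \<rightarrow> 1\<close> of the adjoint recurrence
  \<open>T\<^sub>n = \<beta>\<^sub>n T\<^bsub>n+1\<^esub> + \<alpha>\<^bsub>n+1\<^esub> T\<^bsub>n+2\<^esub>\<close>. Hence \<open>X\<^bsub>n+1\<^esub> T\<^sub>n + \<alpha>\<^sub>n X\<^sub>n T\<^bsub>n+1\<^esub>\<close> does not depend on \<open>n\<close>, and its
  value is the limit of \<open>X\<^sub>n\<close>.\<close>

section \<open>Infinite products and the tail series\<close>

lemma power_Suc_neq_1_if_norm_less_1:
  fixes q :: complex
  assumes "norm q < 1"
  shows "q ^ Suc n \<noteq> 1"
proof
  assume "q ^ Suc n = 1"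
  then have "norm q ^ Suc n = 1"
    by (metis norm_one norm_power)
  with assms show False
    by (metis norm_ge_zero power_Suc_less_one power_less_one_iff less_irrefl zero_less_Suc)
qed

lemma qpoch_Suc: "qpoch x q (Suc n) = qpoch x q n * (1 - x * q ^ n)"
  by (simp add: qpoch_def)

lemma qpoch_q_q_neq_0:
  assumes "norm q < 1"
  shows "qpoch q q n \<noteq> 0"
  using power_Suc_neq_1_if_norm_less_1[OF assms] by (auto simp: qpoch_def)

lemma qpoch_hom_Suc: "qpoch_hom x y q (Suc n) = qpoch_hom x y q n * (x + y * q ^ n)"
  by (simp add: qpoch_hom_def)

lemma triangle_Suc: "Suc n * (Suc n + 1) div 2 = n * (n + 1) div 2 + Suc n"
proof -
  have "Suc n * (Suc n + 1) = n * (n + 1) + Suc n * 2" by simp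
  then show ?thesis by (metis div_mult_self1 zero_neq_numeral add.commute)
qed

lemma triangle_pred_Suc: "Suc n * (Suc n - 1) div 2 = n * (n - 1) div 2 + n"
proof (cases n)
  case (Suc m)
  then show ?thesis using triangle_Suc[of m] by (simp add: mult.commute)
qed simp

lemma convergent_prod_qpoch:
  assumes "norm q < 1"
  shows "convergent_prod (\<lambda>k. 1 - x * q ^ k :: complex)"
proof (rule abs_convergent_prod_imp_convergent_prod)
  show "abs_convergent_prod (\<lambda>k. 1 - x * q ^ k)"
    unfolding abs_convergent_prod_conv_summable
    using assms by (auto simp: norm_mult norm_power intro!: summable_mult summable_geometric)
qed

lemma qpoch_LIMSEQ:
  assumes "norm q < 1"
  shows "(\<lambda>n. qpoch x q n) \<longlonglongrightarrow> qpoch_inf x q"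
proof -
  have "(\<lambda>n. qpoch x q (Suc n)) \<longlonglongrightarrow> qpoch_inf x q"
    using convergent_prod_LIMSEQ[OF convergent_prod_qpoch[OF assms, of x]]
    by (simp add: qpoch_def qpoch_inf_def lessThan_Suc_atMost)
  then show ?thesis by (rule LIMSEQ_imp_Suc)
qed

lemma qpoch_shift: "qpoch x q (m + n) = qpoch x q m * qpoch (x * q ^ m) q n"
  by (induction n) (simp_all add: qpoch_def power_add mult.assoc)

lemma qpoch_inf_split:
  assumes "norm q < 1"
  shows "qpoch_inf x q = qpoch x q m * qpoch_inf (x * q ^ m) q"
proof (rule LIMSEQ_unique)
  show "(\<lambda>n. qpoch x q (n + m)) \<longlonglongrightarrow> qpoch_inf x q"
    using qpoch_LIMSEQ[OF assms, of x] by (rule LIMSEQ_ignore_initial_segment)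
  show "(\<lambda>n. qpoch x q (n + m)) \<longlonglongrightarrow> qpoch x q m * qpoch_inf (x * q ^ m) q"
    unfolding add.commute[of _ m] qpoch_shift
    by (intro tendsto_intros qpoch_LIMSEQ assms)
qed

lemma qpoch_inf_nonzero:
  assumes "norm q < 1" and "\<And>k. 1 - x * q ^ k \<noteq> 0"
  shows "qpoch_inf x q \<noteq> 0"
  unfolding qpoch_inf_def
  using convergent_prod_qpoch[OF assms(1)] assms(2) by (rule prodinf_nonzero)

text \<open>The tail is the full product divided by a partial product, and the partial products tend
  to the full one. This argument needs a full product that does not vanish.\<close>

lemma qpoch_inf_tail_tendsto_1:
  assumes q: "norm q < 1"
  shows "(\<lambda>n. qpoch_inf (x * q ^ n) q) \<longlonglongrightarrow> 1"
proof -
  have "(\<lambda>k. x * q ^ k) \<longlonglongrightarrow> 0"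
    using tendsto_mult_right_zero[OF LIMSEQ_power_zero[OF q]] by simp
  then have "\<forall>\<^sub>F k in sequentially. dist (x * q ^ k) 0 < 1"
    by (rule tendstoD) simp
  then obtain m where m: "\<And>k. k \<ge> m \<Longrightarrow> norm (x * q ^ k) < 1"
    by (auto simp: eventually_sequentially)
  \<comment> \<open>From index \<open>m\<close> on every factor is \<open>1 - z\<close> with
    \<open>norm z < 1\<close>, so the product starting at \<open>y\<close> is nonzero and can be
    divided by.\<close>
  define y where "y = x * q ^ m"
  have nz: "1 - y * q ^ k \<noteq> 0" for k
    using m[of "m + k"] by (auto simp: y_def power_add mult.assoc)
  have inf_nz: "qpoch_inf y q \<noteq> 0"
    by (rule qpoch_inf_nonzero[OF q nz])
  have "qpoch_inf (y * q ^ n) q = qpoch_inf y q / qpoch y q n" for n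
    using qpoch_inf_split[OF q, of y n] nz by (auto simp: qpoch_def field_simps)
  moreover have "(\<lambda>n. qpoch_inf y q / qpoch y q n) \<longlonglongrightarrow> qpoch_inf y q / qpoch_inf y q"
    by (intro tendsto_intros qpoch_LIMSEQ q inf_nz)
  ultimately have "(\<lambda>n. qpoch_inf (x * q ^ (n + m)) q) \<longlonglongrightarrow> 1"
    using inf_nz by (simp add: y_def power_add mult_ac)
  then show ?thesis by (rule LIMSEQ_offset)
qed

section \<open>The \<open>q\<close>-series and its contiguous relations\<close>

definition qseries_coeff :: "complex \<Rightarrow> complex \<Rightarrow> complex \<Rightarrow> nat \<Rightarrow> complex" where
  "qseries_coeff b c q j = q ^ (j * (j + 1) div 2) * qpoch_hom b c q j / qpoch q q j"

lemma qseries_coeff_Suc: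
  assumes "norm q < 1"
  shows "qseries_coeff b c q (Suc j) * (1 - q ^ Suc j) =
    qseries_coeff b c q j * (q ^ Suc j * (b + c * q ^ j))"
proof -
  have "1 - q ^ Suc j \<noteq> 0" "qpoch q q j \<noteq> 0"
    using power_Suc_neq_1_if_norm_less_1[OF assms, of j] qpoch_q_q_neq_0[OF assms] by auto
  then show ?thesis
    unfolding qseries_coeff_def triangle_Suc qpoch_hom_Suc qpoch_Suc power_add
    by (simp add: divide_simps)
qed

text \<open>The quotient of consecutive coefficients contains the factor \<open>q ^ Suc j\<close>
  and therefore tends to 0, so the ratio test applies.\<close>

lemma summable_norm_qseries_coeff:
  assumes q: "norm q < 1"
  shows "summable (\<lambda>j. norm (qseries_coeff b c q j))"
proof -
  have "(\<lambda>j. q ^ Suc j * (b + c * q ^ j) / (1 - q ^ Suc j)) \<longlonglongrightarrow> 0 * (b + c * 0) / (1 - 0)"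
    by (intro tendsto_intros LIMSEQ_power_zero LIMSEQ_Suc q) auto
  then have "\<forall>\<^sub>F j in sequentially. dist (q ^ Suc j * (b + c * q ^ j) / (1 - q ^ Suc j)) 0 < 1 / 2"
    by (intro tendstoD) auto
  then obtain m where m: "\<And>j. j \<ge> m \<Longrightarrow> norm (q ^ Suc j * (b + c * q ^ j) / (1 - q ^ Suc j)) < 1 / 2"
    by (auto simp: eventually_sequentially)
  have "norm (qseries_coeff b c q (Suc j)) \<le> 1 / 2 * norm (qseries_coeff b c q j)" if "j \<ge> m" for j
  proof -
    have "1 - q ^ Suc j \<noteq> 0" using power_Suc_neq_1_if_norm_less_1[OF q, of j] by auto
    then have "qseries_coeff b c q (Suc j) =
        (q ^ Suc j * (b + c * q ^ j) / (1 - q ^ Suc j)) * qseries_coeff b c q j"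
      using qseries_coeff_Suc[OF q, of b c j] by (simp add: field_simps)
    then show ?thesis
      using mult_right_mono[OF less_imp_le[OF m[OF that]] norm_ge_zero] by (simp only: norm_mult)
  qed
  then show ?thesis
    by (intro summable_ratio_test[where c = "1 / 2" and N = m]) auto
qed

text \<open>For \<open>s = r + 1\<close> this is the value of \<open>(-aq;q)\<^sub>\<infinity> \<Sum>\<^sub>j \<dots>\<close> in the limit of the numerators, at the parameters
  \<open>aq\<^sup>r, bq\<^sup>r, cq\<^sup>r\<close>, with the quotients \<open>(-aq;q)\<^sub>\<infinity> / (-aq;q)\<^sub>j\<close> contracted, so that no denominator
  can vanish. Separating the two indices makes the contiguous relations below two-term shifts.\<close>

definition qseries :: "complex \<Rightarrow> complex \<Rightarrow> complex \<Rightarrow> complex \<Rightarrow> nat \<Rightarrow> nat \<Rightarrow> complex" where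
  "qseries a b c q r s =
     (\<Sum>j. qseries_coeff b c q j * q ^ (j * r) * qpoch_inf (- a * q ^ (j + s)) q)"

lemma qpoch_inf_bounded:
  assumes "norm q < 1"
  obtains K where "K > 0" "\<And>n. norm (qpoch_inf (x * q ^ n) q) \<le> K"
proof -
  have "Bseq (\<lambda>n. qpoch_inf (x * q ^ n) q)"
    using qpoch_inf_tail_tendsto_1[OF assms] by (intro convergent_imp_Bseq) (auto simp: convergent_def)
  then show ?thesis using that by (auto elim!: BseqE)
qed

text \<open>The bound is uniform in both exponents. It gives summability for all \<open>r\<close>
  and \<open>s\<close>, and later a bound on the remainder that does not depend on
  \<open>k\<close>.\<close>

lemma norm_qseries_term_le:
  assumes "norm q < 1" and "\<And>n. norm (qpoch_inf (- a * q ^ n) q) \<le> K"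
  shows "norm (qseries_coeff b c q i * q ^ m * qpoch_inf (- a * q ^ n) q)
    \<le> norm (qseries_coeff b c q i) * K"
proof -
  have "norm q ^ m \<le> 1" using assms(1) by (simp add: power_le_one)
  then have "norm (qseries_coeff b c q i) * norm q ^ m \<le> norm (qseries_coeff b c q i)"
    by (simp add: mult_left_le)
  then show ?thesis
    unfolding norm_mult norm_power using assms(2) by (intro mult_mono) auto
qed

lemma summable_qseries:
  assumes "norm q < 1"
  shows "summable (\<lambda>j. qseries_coeff b c q j * q ^ (j * r) * qpoch_inf (- a * q ^ (j + s)) q)"
proof -
  obtain K where "\<And>n. norm (qpoch_inf (- a * q ^ n) q) \<le> K"
    using qpoch_inf_bounded[OF assms] by metis
  then show ?thesis
    using norm_qseries_term_le[OF assms]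
    by (intro summable_comparison_test'[OF summable_mult2[OF summable_norm_qseries_coeff[OF assms]]])
      blast
qed

lemma qseries_sums:
  assumes "norm q < 1"
  shows "(\<lambda>j. qseries_coeff b c q j * q ^ (j * r) * qpoch_inf (- a * q ^ (j + s)) q)
    sums qseries a b c q r s"
  unfolding qseries_def using summable_qseries[OF assms] by (rule summable_sums)

lemma qpoch_inf_Suc:
  assumes "norm q < 1"
  shows "qpoch_inf (- a * q ^ n) q = (1 + a * q ^ n) * qpoch_inf (- a * q ^ Suc n) q"
  using qpoch_inf_split[OF assms, of "- a * q ^ n" 1] by (simp add: qpoch_def mult_ac)

text \<open>The first factor \<open>1 + a * q ^ (j + s)\<close> is split off each infinite product;
  its \<open>q ^ j\<close> is absorbed by raising \<open>r\<close> to \<open>Suc r\<close>.\<close>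

lemma qseries_shift_product:
  assumes "norm q < 1"
  shows "qseries a b c q r s =
    qseries a b c q r (Suc s) + a * q ^ s * qseries a b c q (Suc r) (Suc s)"
proof (rule sums_unique2[OF qseries_sums[OF assms]])
  have "qseries_coeff b c q j * q ^ (j * r) * qpoch_inf (- a * q ^ (j + s)) q =
     qseries_coeff b c q j * q ^ (j * r) * qpoch_inf (- a * q ^ (j + Suc s)) q +
     a * q ^ s * (qseries_coeff b c q j * q ^ (j * Suc r) * qpoch_inf (- a * q ^ (j + Suc s)) q)" for j
    unfolding qpoch_inf_Suc[OF assms, of a "j + s"] by (simp add: algebra_simps power_add)
  then show "(\<lambda>j. qseries_coeff b c q j * q ^ (j * r) * qpoch_inf (- a * q ^ (j + s)) q) sums
      (qseries a b c q r (Suc s) + a * q ^ s * qseries a b c q (Suc r) (Suc s))"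
    by (simp only:) (intro sums_add sums_mult qseries_sums assms)
qed

text \<open>The difference multiplies the \<open>j\<close>-th term by \<open>1 - q ^ j\<close>. This
  kills the term \<open>j = 0\<close> and cancels the last factor of \<open>qpoch q q j\<close>,
  after which the index is shifted by one.\<close>

lemma qseries_shift_power:
  assumes "norm q < 1"
  shows "qseries a b c q r s - qseries a b c q (Suc r) s =
    q ^ Suc r * (b * qseries a b c q (Suc r) (Suc s) + c * qseries a b c q (r + 2) (Suc s))"
proof (rule sums_unique2)
  define f where "f = (\<lambda>j. qseries_coeff b c q j * q ^ (j * r) * qpoch_inf (- a * q ^ (j + s)) q
    - qseries_coeff b c q j * q ^ (j * Suc r) * qpoch_inf (- a * q ^ (j + s)) q)"
  have f: "f sums (qseries a b c q r s - qseries a b c q (Suc r) s)"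
    unfolding f_def by (intro sums_diff qseries_sums assms)
  have "f 0 = 0" by (simp add: f_def)
  with f show "(\<lambda>j. f (Suc j)) sums (qseries a b c q r s - qseries a b c q (Suc r) s)"
    by (simp add: sums_Suc_iff)
  have "f (Suc j) = q ^ Suc r *
     (b * (qseries_coeff b c q j * q ^ (j * Suc r) * qpoch_inf (- a * q ^ (j + Suc s)) q) +
      c * (qseries_coeff b c q j * q ^ (j * (r + 2)) * qpoch_inf (- a * q ^ (j + Suc s)) q))" for j
  proof -
    have "f (Suc j) = qseries_coeff b c q (Suc j) * (1 - q ^ Suc j) * q ^ (Suc j * r) *
        qpoch_inf (- a * q ^ (j + Suc s)) q"
      by (simp add: f_def algebra_simps power_add)
    then show ?thesis
      unfolding qseries_coeff_Suc[OF assms] by (simp add: algebra_simps power_add power2_eq_square)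
  qed
  then show "(\<lambda>j. f (Suc j)) sums
      (q ^ Suc r * (b * qseries a b c q (Suc r) (Suc s) + c * qseries a b c q (r + 2) (Suc s)))"
    by (simp only:) (intro sums_add sums_mult qseries_sums assms)
qed

text \<open>This is the adjoint recurrence for \<open>d = 1\<close>. A product shift followed by a
  power shift leaves the diagonal \<open>s = r + 1\<close> only through the series at
  \<open>(k + 1, k + 3)\<close>; a product shift read backwards eliminates that one.\<close>

lemma qseries_diagonal_recurrence:
  assumes "norm q < 1"
  shows "qseries a b c q k (Suc k) =
    (1 + (a + b) * q ^ Suc k) * qseries a b c q (Suc k) (k + 2) +
    (c * q ^ Suc k - a * b * q ^ (2 * Suc k + 1)) * qseries a b c q (k + 2) (k + 3)"
proof -
  have 1: "qseries a b c q k (Suc k) =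
      qseries a b c q k (k + 2) + a * q ^ Suc k * qseries a b c q (Suc k) (k + 2)"
    using qseries_shift_product[OF assms, of a b c k "Suc k"] by simp
  have 2: "qseries a b c q k (k + 2) = qseries a b c q (Suc k) (k + 2) +
      q ^ Suc k * (b * qseries a b c q (Suc k) (k + 3) + c * qseries a b c q (k + 2) (k + 3))"
    using qseries_shift_power[OF assms, of a b c k "k + 2"] by (simp add: algebra_simps eval_nat_numeral)
  have 3: "qseries a b c q (Suc k) (k + 3) =
      qseries a b c q (Suc k) (k + 2) - a * q ^ (k + 2) * qseries a b c q (k + 2) (k + 3)"
    using qseries_shift_product[OF assms, of a b c "Suc k" "k + 2"]
    by (simp add: algebra_simps eval_nat_numeral)
  have 4: "q ^ (2 * Suc k + 1) = q ^ Suc k * q ^ (k + 2)"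
    unfolding power_add[symmetric] by (rule arg_cong) simp
  show ?thesis
    unfolding 1 2 3 4 by (simp add: algebra_simps)
qed

text \<open>Only the term \<open>j = 0\<close> survives, and it is a tail of a convergent
  product.\<close>

lemma qseries_diagonal_tendsto_1:
  assumes q: "norm q < 1"
  shows "(\<lambda>k. qseries a b c q k (Suc k)) \<longlonglongrightarrow> 1"
proof -
  obtain K where K: "\<And>n. norm (qpoch_inf (- a * q ^ n) q) \<le> K"
    using qpoch_inf_bounded[OF q] by metis
  define v where "v = qseries_coeff b c q"
  \<comment> \<open>The terms with \<open>j > 0\<close> share the factor \<open>q ^ k\<close>;
    \<open>R k\<close> is what remains of their sum, and it is bounded uniformly in
    \<open>k\<close>.\<close>
  define R where "R k = (\<Sum>j. v (Suc j) * q ^ (j * k) * qpoch_inf (- a * q ^ (j + k + 2)) q)" for k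
  have sv: "summable (\<lambda>j. norm (v (Suc j)) * K)"
    using summable_norm_qseries_coeff[OF q, of b c] unfolding v_def
    by (subst (asm) summable_Suc_iff[symmetric]) (rule summable_mult2)
  have le: "norm (v (Suc j) * q ^ (j * k) * qpoch_inf (- a * q ^ (j + k + 2)) q)
      \<le> norm (v (Suc j)) * K" for j k
    unfolding v_def by (rule norm_qseries_term_le[OF q K])
  have sR: "summable (\<lambda>j. v (Suc j) * q ^ (j * k) * qpoch_inf (- a * q ^ (j + k + 2)) q)" for k
    by (rule summable_comparison_test'[OF sv le])
  have R_le: "norm (R k) \<le> (\<Sum>j. norm (v (Suc j)) * K)" for k
    unfolding R_def by (rule norm_suminf_le[OF le sv])
  have "qseries a b c q k (Suc k) = qpoch_inf (- a * q ^ Suc k) q + q ^ k * R k" for k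
  proof -
    let ?f = "\<lambda>j. v j * q ^ (j * k) * qpoch_inf (- a * q ^ (j + Suc k)) q"
    have "qseries a b c q k (Suc k) = ?f 0 + (\<Sum>j. ?f (Suc j))"
      using suminf_split_head[OF summable_qseries[OF q, of b c k a "Suc k"]]
      by (simp add: qseries_def v_def)
    also have "(\<Sum>j. ?f (Suc j)) = (\<Sum>j. q ^ k * (v (Suc j) * q ^ (j * k) * qpoch_inf (- a * q ^ (j + k + 2)) q))"
      by (simp add: power_add mult_ac)
    also have "\<dots> = q ^ k * R k"
      unfolding R_def by (rule suminf_mult[OF sR])
    finally show ?thesis
      by (simp add: v_def qseries_coeff_def qpoch_hom_def qpoch_def)
  qed
  moreover have "(\<lambda>k. q ^ k * R k) \<longlonglongrightarrow> 0"
    by (rule lim_null_mult_right_bounded[OF LIMSEQ_power_zero[OF q] eventuallyI[OF R_le]])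
  moreover have "(\<lambda>k. qpoch_inf (- a * q ^ Suc k) q) \<longlonglongrightarrow> 1"
    by (rule LIMSEQ_Suc[OF qpoch_inf_tail_tendsto_1[OF q]])
  ultimately show ?thesis
    using tendsto_add[of "\<lambda>k. qpoch_inf (- a * q ^ Suc k) q" 1 sequentially "\<lambda>k. q ^ k * R k" 0]
    by simp
qed

section \<open>Three-term recurrences with limiting coefficients 1 and 0\<close>

text \<open>A Casoratian-like pairing of a solution with a solution of the adjoint recurrence: on
  inserting both recurrences, the terms with \<open>\<beta> n\<close> cancel.\<close>

lemma three_term_invariant:
  fixes X T \<alpha> \<beta> :: "nat \<Rightarrow> complex"
  assumes X: "\<And>n. X (Suc (Suc n)) = \<beta> n * X (Suc n) + \<alpha> n * X n"
    and T: "\<And>n. T n = \<beta> n * T (Suc n) + \<alpha> (Suc n) * T (Suc (Suc n))"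
  shows "X (Suc n) * T n + \<alpha> n * X n * T (Suc n) = X 1 * T 0 + \<alpha> 0 * X 0 * T 1"
proof (induction n)
  case (Suc n)
  have "X (Suc (Suc n)) * T (Suc n) + \<alpha> (Suc n) * X (Suc n) * T (Suc (Suc n)) =
      X (Suc n) * T n + \<alpha> n * X n * T (Suc n)"
    unfolding X T[of n] by (simp add: algebra_simps)
  with Suc show ?case by simp
qed simp

text \<open>Dividing the invariant by \<open>T n\<close> turns the recurrence into the first-order
  recursion \<open>X (Suc n) = L / T n - \<epsilon> n * X n\<close> with \<open>\<epsilon>\<close>
  tending to 0. It keeps \<open>X\<close> bounded, so the last term vanishes in the limit.\<close>

lemma three_term_tendsto:
  fixes X T \<alpha> \<beta> :: "nat \<Rightarrow> complex"
  assumes X: "\<And>n. X (Suc (Suc n)) = \<beta> n * X (Suc n) + \<alpha> n * X n"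
    and T: "\<And>n. T n = \<beta> n * T (Suc n) + \<alpha> (Suc n) * T (Suc (Suc n))"
    and T1: "T \<longlonglongrightarrow> 1" and \<alpha>0: "\<alpha> \<longlonglongrightarrow> 0"
  shows "X \<longlonglongrightarrow> X 1 * T 0 + \<alpha> 0 * X 0 * T 1"
proof -
  define L where "L = X 1 * T 0 + \<alpha> 0 * X 0 * T 1"
  define \<epsilon> where "\<epsilon> n = \<alpha> n * T (Suc n) / T n" for n
  note inv = three_term_invariant[of X \<beta> \<alpha> T, OF X T, folded L_def]
  have LT: "(\<lambda>n. L / T n) \<longlonglongrightarrow> L / 1"
    by (intro tendsto_intros T1) simp
  have "\<epsilon> \<longlonglongrightarrow> 0 * 1 / 1"
    unfolding \<epsilon>_def by (intro tendsto_intros T1 \<alpha>0 LIMSEQ_Suc) simp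
  then have \<epsilon>: "\<epsilon> \<longlonglongrightarrow> 0" by simp
  have "\<forall>\<^sub>F n in sequentially. T n \<noteq> 0"
    by (rule tendsto_imp_eventually_ne[OF T1]) simp
  moreover have "\<forall>\<^sub>F n in sequentially. dist (\<epsilon> n) 0 < 1 / 2"
    by (rule tendstoD[OF \<epsilon>]) simp
  moreover have "\<forall>\<^sub>F n in sequentially. dist (L / T n) (L / 1) < 1"
    by (rule tendstoD[OF LT]) simp
  ultimately have "\<forall>\<^sub>F n in sequentially. T n \<noteq> 0 \<and> norm (\<epsilon> n) < 1 / 2 \<and> dist (L / T n) L < 1"
    by eventually_elim simp
  then obtain m where m: "\<And>n. n \<ge> m \<Longrightarrow> T n \<noteq> 0 \<and> norm (\<epsilon> n) < 1 / 2 \<and> dist (L / T n) L < 1"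
    by (auto simp: eventually_sequentially)
  have X_step: "X (Suc n) = L / T n - \<epsilon> n * X n" if "n \<ge> m" for n
  proof -
    have "X (Suc n) * T n = L - \<alpha> n * X n * T (Suc n)"
      using inv[of n] by (simp add: eq_diff_eq)
    then have "X (Suc n) = (L - \<alpha> n * X n * T (Suc n)) / T n"
      using m[OF that] by (metis nonzero_mult_div_cancel_right)
    then show ?thesis by (simp add: \<epsilon>_def diff_divide_distrib mult_ac)
  qed
  \<comment> \<open>The choice \<open>B \<ge> 2 * (norm L + 1)\<close> makes the bound reproduce
    itself, since then \<open>(norm L + 1) + B / 2 \<le> B\<close>.\<close>
  define B where "B = max (norm (X m)) (2 * (norm L + 1))"
  have bound: "norm (X n) \<le> B" if "n \<ge> m" for n
    using that
  proof (induction n rule: dec_induct)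
    case (step n)
    have "norm (L / T n) \<le> norm L + 1"
      using m[OF step(1)] norm_triangle_sub[of "L / T n" L] by (simp add: dist_norm)
    moreover have "norm (\<epsilon> n * X n) \<le> 1 / 2 * B"
      unfolding norm_mult using m[OF step(1)] step(3) by (intro mult_mono) auto
    ultimately have "norm (X (Suc n)) \<le> (norm L + 1) + 1 / 2 * B"
      unfolding X_step[OF step(1)] by (intro order.trans[OF norm_triangle_ineq4] add_mono)
    also have "\<dots> \<le> B"
    proof -
      have "2 * (norm L + 1) \<le> B" by (simp add: B_def)
      then show ?thesis by simp
    qed
    finally show ?case .
  qed (simp add: B_def)
  have "(\<lambda>n. \<epsilon> n * X n) \<longlonglongrightarrow> 0"
    by (rule lim_null_mult_right_bounded[OF \<epsilon>, of _ B])
      (use bound in \<open>auto simp: eventually_sequentially\<close>)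
  from tendsto_diff[OF LT this] have "(\<lambda>n. L / T n - \<epsilon> n * X n) \<longlonglongrightarrow> L" by simp
  moreover have "\<forall>\<^sub>F n in sequentially. L / T n - \<epsilon> n * X n = X (Suc n)"
    unfolding eventually_sequentially using X_step by metis
  ultimately have "(\<lambda>n. X (Suc n)) \<longlonglongrightarrow> L"
    by (rule Lim_transform_eventually)
  then show ?thesis
    unfolding L_def by (rule LIMSEQ_imp_Suc)
qed

text \<open>If both limits vanish, then both solutions are eventually multiples of the same subdominant
  solution, because the invariant forces \<open>X (n + 1) / X n\<close> to be independent of \<open>X\<close>.\<close>

lemma three_term_ratio_converges:
  fixes X Y T \<alpha> \<beta> :: "nat \<Rightarrow> complex"
  assumes X: "\<And>n. X (Suc (Suc n)) = \<beta> n * X (Suc n) + \<alpha> n * X n"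
    and Y: "\<And>n. Y (Suc (Suc n)) = \<beta> n * Y (Suc n) + \<alpha> n * Y n"
    and T: "\<And>n. T n = \<beta> n * T (Suc n) + \<alpha> (Suc n) * T (Suc (Suc n))"
    and T1: "T \<longlonglongrightarrow> 1" and \<alpha>0: "\<alpha> \<longlonglongrightarrow> 0"
    and nz: "\<exists>\<^sub>F n in sequentially. X n \<noteq> 0 \<or> Y n \<noteq> 0"
  shows "(\<exists>v. (\<forall>\<^sub>F n in sequentially. Y n \<noteq> 0) \<and> (\<lambda>n. X n / Y n) \<longlonglongrightarrow> v) \<or>
    ((\<forall>\<^sub>F n in sequentially. X n \<noteq> 0) \<and> (\<lambda>n. Y n / X n) \<longlonglongrightarrow> 0)"
proof -
  define L where "L = X 1 * T 0 + \<alpha> 0 * X 0 * T 1"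
  define M where "M = Y 1 * T 0 + \<alpha> 0 * Y 0 * T 1"
  have XL: "X \<longlonglongrightarrow> L" unfolding L_def by (rule three_term_tendsto[OF X T T1 \<alpha>0])
  have YM: "Y \<longlonglongrightarrow> M" unfolding M_def by (rule three_term_tendsto[OF Y T T1 \<alpha>0])
  consider "M \<noteq> 0" | "M = 0" "L \<noteq> 0" | "M = 0" "L = 0" by blast
  then show ?thesis
  proof cases
    case 1
    then have "\<forall>\<^sub>F n in sequentially. Y n \<noteq> 0" "(\<lambda>n. X n / Y n) \<longlonglongrightarrow> L / M"
      by (auto intro!: tendsto_imp_eventually_ne[OF YM] tendsto_divide[OF XL YM])
    then show ?thesis by blast
  next
    case 2
    have "\<forall>\<^sub>F n in sequentially. X n \<noteq> 0"
      by (rule tendsto_imp_eventually_ne[OF XL \<open>L \<noteq> 0\<close>])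
    moreover have "(\<lambda>n. Y n / X n) \<longlonglongrightarrow> 0"
      using tendsto_divide[OF YM XL \<open>L \<noteq> 0\<close>] by (simp add: \<open>M = 0\<close>)
    ultimately show ?thesis by blast
  next
    case 3
    have "\<forall>\<^sub>F n in sequentially. T n \<noteq> 0"
      by (rule tendsto_imp_eventually_ne[OF T1]) simp
    then obtain m where m: "\<And>n. n \<ge> m \<Longrightarrow> T n \<noteq> 0"
      by (auto simp: eventually_sequentially)
    have ev: "\<forall>\<^sub>F k in sequentially. P k" if "\<And>n. P (m + n)" for P
    proof -
      have "P n" if "n \<ge> m" for n
        using \<open>\<And>n. P (m + n)\<close>[of "n - m"] that by simp
      then show ?thesis unfolding eventually_sequentially by blast
    qed
    define \<rho> where "\<rho> n = - \<alpha> n * T (Suc n) / T n" for n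
    have step: "z = \<rho> n * w" if "n \<ge> m" "z * T n + \<alpha> n * w * T (Suc n) = 0" for n z w
    proof -
      have "z * T n = - (\<alpha> n * w * T (Suc n))"
        using that(2) by (rule eq_neg_iff_add_eq_0[THEN iffD2])
      then have "z = - (\<alpha> n * w * T (Suc n)) / T n"
        by (metis m[OF that(1)] nonzero_mult_div_cancel_right)
      then show ?thesis by (simp add: \<rho>_def mult_ac)
    qed
    have X_step: "X (Suc n) = \<rho> n * X n" if "n \<ge> m" for n
      using three_term_invariant[of X \<beta> \<alpha> T n, OF X T] 3 by (intro step that) (simp add: L_def)
    have Y_step: "Y (Suc n) = \<rho> n * Y n" if "n \<ge> m" for n
      using three_term_invariant[of Y \<beta> \<alpha> T n, OF Y T] 3 by (intro step that) (simp add: M_def)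
    define \<pi> where "\<pi> n = (\<Prod>i<n. \<rho> (m + i))" for n
    have X_eq: "X (m + n) = \<pi> n * X m" and Y_eq: "Y (m + n) = \<pi> n * Y m" for n
      by (induction n) (simp_all add: \<pi>_def X_step Y_step)
    \<comment> \<open>A product that vanishes once stays zero, which would make \<open>X\<close> and
      \<open>Y\<close> both vanish eventually, against \<open>nz\<close>.\<close>
    have \<pi>_nz: "\<pi> n \<noteq> 0" for n
    proof
      assume "\<pi> n = 0"
      then have "\<pi> (n + i) = 0" for i
        by (induction i) (simp_all add: \<pi>_def)
      then have "\<forall>\<^sub>F k in sequentially. \<pi> (k - m) = 0"
        unfolding eventually_sequentially
        by (intro exI[of _ "m + n"]) (metis add_diff_cancel_left' add.assoc le_Suc_ex)
      moreover have "\<forall>\<^sub>F k in sequentially. X k = \<pi> (k - m) * X m \<and> Y k = \<pi> (k - m) * Y m"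
        by (rule ev) (simp add: X_eq Y_eq)
      ultimately have "\<forall>\<^sub>F k in sequentially. \<not> (X k \<noteq> 0 \<or> Y k \<noteq> 0)"
        by eventually_elim simp
      with nz show False by (simp add: frequently_def)
    qed
    have nzm: "X m \<noteq> 0 \<or> Y m \<noteq> 0"
    proof (rule ccontr)
      assume "\<not> ?thesis"
      then have "\<forall>\<^sub>F k in sequentially. \<not> (X k \<noteq> 0 \<or> Y k \<noteq> 0)"
        by (intro ev) (simp add: X_eq Y_eq)
      with nz show False by (simp add: frequently_def)
    qed
    show ?thesis
    proof (cases "Y m = 0")
      case True
      have "\<forall>\<^sub>F k in sequentially. X k \<noteq> 0"
        by (rule ev) (use True nzm \<pi>_nz in \<open>simp add: X_eq\<close>)
      moreover have "\<forall>\<^sub>F k in sequentially. Y k / X k = 0"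
        by (rule ev) (use True in \<open>simp add: Y_eq\<close>)
      ultimately show ?thesis by (simp add: tendsto_eventually)
    next
      case False
      have "\<forall>\<^sub>F k in sequentially. Y k \<noteq> 0"
        by (rule ev) (use False \<pi>_nz in \<open>simp add: Y_eq\<close>)
      moreover have "\<forall>\<^sub>F k in sequentially. X k / Y k = X m / Y m"
        by (rule ev) (use \<pi>_nz in \<open>simp add: X_eq Y_eq\<close>)
      ultimately show ?thesis by (blast intro: tendsto_eventually)
    qed
  qed
qed

section \<open>Gaussian polynomials as power series coefficients\<close>

unbundle no vec_syntax and fps_syntax

lemma gauss_binom_add:
  "gauss_binom q (int (m + k)) (int m) = qpoch q q (m + k) / (qpoch q q m * qpoch q q k)"
  unfolding gauss_binom_def by (simp add: nat_add_distrib)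

text \<open>After clearing the common factors this is \<open>1 - q ^ (n + 1) = (1 - q ^ (n - m)) + q
  ^ (n - m) * (1 - q ^ (m + 1))\<close>. The case \<open>m = n\<close> is separate because there the
  first summand is 0 by the range convention, not by the quotient formula.\<close>

lemma gauss_binom_pascal:
  assumes q: "norm q < 1" and "m \<le> n"
  shows "gauss_binom q (int (Suc n)) (int (Suc m)) =
    gauss_binom q (int n) (int (Suc m)) + q ^ (n - m) * gauss_binom q (int n) (int m)"
proof (cases "m = n")
  case True
  then show ?thesis using qpoch_q_q_neq_0[OF q] by (simp add: gauss_binom_def qpoch_def)
next
  case False
  with \<open>m \<le> n\<close> obtain p where n: "n = m + Suc p"
    by (metis add_Suc_right less_iff_Suc_add nat_less_le)
  have nz: "1 - q * q ^ k \<noteq> 0" "qpoch q q k \<noteq> 0" for k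
    using power_Suc_neq_1_if_norm_less_1[OF q, of k] qpoch_q_q_neq_0[OF q] by auto
  have 1: "gauss_binom q (int (Suc n)) (int (Suc m)) = 
      qpoch q q n * (1 - q * q ^ n) / (qpoch q q m * (1 - q * q ^ m) * (qpoch q q p * (1 - q * q ^ p)))"
    using gauss_binom_add[of q "Suc m" "Suc p"] by (simp add: n qpoch_Suc)
  have 2: "gauss_binom q (int n) (int (Suc m)) =
      qpoch q q n / (qpoch q q m * (1 - q * q ^ m) * qpoch q q p)"
    using gauss_binom_add[of q "Suc m" p] by (simp add: n qpoch_Suc)
  have 3: "gauss_binom q (int n) (int m) =
      qpoch q q n / (qpoch q q m * (qpoch q q p * (1 - q * q ^ p)))"
    using gauss_binom_add[of q m "Suc p"] by (simp add: n qpoch_Suc)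
  have 4: "q ^ (n - m) = q * q ^ p" "q ^ n = q ^ m * (q * q ^ p)"
    by (simp_all add: n power_add)
  show ?thesis
    unfolding 1 2 3 4 using nz[of m] nz[of p] by (simp add: divide_simps) (simp add: algebra_simps)
qed

lemma gauss_binom_0_right: "norm q < 1 \<Longrightarrow> gauss_binom q (int n) 0 = 1"
  using qpoch_q_q_neq_0 by (simp add: gauss_binom_def qpoch_def)

text \<open>With \<open>z\<close> for \<open>fps_X\<close> this is \<open>1 / (xz; q)\<close> with
  index \<open>k + 1\<close>: there are \<open>k + 1\<close> factors, whereas
  \<open>fps_qpoch_hom\<close> has \<open>k\<close>.\<close>

definition fps_qpoch_inverse :: "complex \<Rightarrow> complex \<Rightarrow> nat \<Rightarrow> complex fps" where
  "fps_qpoch_inverse x q k = (\<Prod>i\<le>k. inverse (1 - fps_const (x * q ^ i) * fps_X))"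

definition fps_qpoch_hom :: "complex \<Rightarrow> complex \<Rightarrow> complex \<Rightarrow> nat \<Rightarrow> complex fps" where
  "fps_qpoch_hom x y q k = (\<Prod>i<k. fps_const x + fps_const (y * q ^ i) * fps_X)"

lemma one_minus_mult_inverse_fps:
  "(1 - fps_const x * fps_X) * inverse (1 - fps_const x * fps_X :: complex fps) = 1"
  by (subst mult.commute, rule inverse_mult_eq_1) simp

lemma fps_qpoch_inverse_0:
  "(1 - fps_const x * fps_X) * fps_qpoch_inverse x q 0 = 1"
  using one_minus_mult_inverse_fps by (simp add: fps_qpoch_inverse_def)

lemma fps_qpoch_inverse_Suc:
  "(1 - fps_const (x * q ^ Suc k) * fps_X) * fps_qpoch_inverse x q (Suc k) = fps_qpoch_inverse x q k"
  unfolding fps_qpoch_inverse_def prod.atMost_Suc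
  by (subst mult.left_commute) (simp only: one_minus_mult_inverse_fps mult_1_right)

lemma fps_linear_mult_nth:
  fixes F :: "complex fps"
  shows "((1 - fps_const x * fps_X) * F) $ 0 = F $ 0"
    and "((1 - fps_const x * fps_X) * F) $ Suc j = F $ Suc j - x * F $ j"
proof -
  have *: "(1 - fps_const x * fps_X) * F = F - fps_const x * (fps_X * F)"
    by (simp add: algebra_simps)
  show "((1 - fps_const x * fps_X) * F) $ 0 = F $ 0"
    and "((1 - fps_const x * fps_X) * F) $ Suc j = F $ Suc j - x * F $ j"
    unfolding * by simp_all
qed

text \<open>The \<open>q\<close>-binomial theorem for reciprocals. Multiplying by the last linear
  factor lowers \<open>k\<close>, and comparing coefficients gives the Pascal rule;
  \<open>k = 0\<close> is the geometric series.\<close>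

lemma fps_qpoch_inverse_nth:
  assumes q: "norm q < 1"
  shows "fps_qpoch_inverse x q k $ j = x ^ j * gauss_binom q (int (k + j)) (int j)"
proof (induction k arbitrary: j)
  case 0
  have "fps_qpoch_inverse x q 0 $ j = x ^ j"
  proof (induction j)
    case 0
    then show ?case using fps_linear_mult_nth(1)[of x "fps_qpoch_inverse x q 0"]
      unfolding fps_qpoch_inverse_0 by simp
  next
    case (Suc j)
    then show ?case using fps_linear_mult_nth(2)[of x "fps_qpoch_inverse x q 0" j]
      unfolding fps_qpoch_inverse_0 by simp
  qed
  then show ?case using qpoch_q_q_neq_0[OF q] by (simp add: gauss_binom_def qpoch_def)
next
  case (Suc k)
  note IH = this
  show ?case
  proof (induction j)
    case 0
    then show ?case
      using fps_linear_mult_nth(1)[of "x * q ^ Suc k" "fps_qpoch_inverse x q (Suc k)"] IH[of 0]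
      unfolding fps_qpoch_inverse_Suc by (simp add: gauss_binom_0_right[OF q, of "Suc k", simplified]
        gauss_binom_0_right[OF q])
  next
    case (Suc j)
    have "fps_qpoch_inverse x q (Suc k) $ Suc j =
        fps_qpoch_inverse x q k $ Suc j + x * q ^ Suc k * fps_qpoch_inverse x q (Suc k) $ j"
      using fps_linear_mult_nth(2)[of "x * q ^ Suc k" "fps_qpoch_inverse x q (Suc k)" j]
      unfolding fps_qpoch_inverse_Suc by simp
    also have "\<dots> = x ^ Suc j * (gauss_binom q (int (Suc k + j)) (int (Suc j)) +
        q ^ (Suc k + j - j) * gauss_binom q (int (Suc k + j)) (int j))"
      unfolding Suc IH by (simp add: algebra_simps)
    also have "\<dots> = x ^ Suc j * gauss_binom q (int (Suc (Suc k + j))) (int (Suc j))"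
      by (subst gauss_binom_pascal[OF q]) simp_all
    finally show ?case by simp
  qed
qed

text \<open>The finite \<open>q\<close>-binomial theorem in homogeneous form. Multiplication by the
  next factor again produces the Pascal rule.\<close>

lemma fps_qpoch_hom_nth:
  assumes q: "norm q < 1"
  shows "fps_qpoch_hom x y q k $ l =
    y ^ l * x ^ (k - l) * q ^ (l * (l - 1) div 2) * gauss_binom q (int k) (int l)"
proof (induction k arbitrary: l)
  case 0
  then show ?case by (cases l) (simp_all add: fps_qpoch_hom_def gauss_binom_def qpoch_def)
next
  case (Suc k)
  have rec: "fps_qpoch_hom x y q (Suc k) =
      fps_const x * fps_qpoch_hom x y q k + fps_const (y * q ^ k) * (fps_X * fps_qpoch_hom x y q k)"
    by (simp add: fps_qpoch_hom_def algebra_simps)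
  show ?case
  proof (cases l)
    case 0
    then show ?thesis
      unfolding rec by (simp add: Suc gauss_binom_0_right[OF q] gauss_binom_0_right[OF q, of "Suc k", simplified])
  next
    case (Suc m)
    have *: "fps_qpoch_hom x y q (Suc k) $ Suc m =
        x * fps_qpoch_hom x y q k $ Suc m + y * q ^ k * fps_qpoch_hom x y q k $ m"
      unfolding rec by simp
    show ?thesis
    proof (cases "m \<le> k")
      case True
      have "x * fps_qpoch_hom x y q k $ Suc m = y ^ Suc m * x ^ (k - m) *
          q ^ (Suc m * (Suc m - 1) div 2) * gauss_binom q (int k) (int (Suc m))"
      \<comment> \<open>For \<open>m = k\<close> the exponent \<open>k - Suc m\<close> is truncated
        to 0 and the powers of \<open>x\<close> do not match, but the Gaussian polynomial is
        0.\<close>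
      proof (cases "m = k")
        case False
        then have "x ^ (k - m) = x * x ^ (k - Suc m)"
          using True by (metis Suc_diff_Suc nat_less_le power_Suc)
        then show ?thesis unfolding Suc.IH by simp
      qed (simp add: Suc.IH gauss_binom_def)
      moreover have "q ^ k = q ^ m * q ^ (k - m)"
        using True by (simp flip: power_add)
      ultimately show ?thesis
        unfolding \<open>l = Suc m\<close> * gauss_binom_pascal[OF q True] Suc.IH[of m] triangle_pred_Suc power_add
        by (simp add: algebra_simps)
    qed (simp add: \<open>l = Suc m\<close> * Suc.IH gauss_binom_def)
  qed
qed

section \<open>Closed forms of the convergents\<close>

text \<open>On sequences let \<open>S\<close> be the shift \<open>P\<^sub>n \<mapsto> P\<^bsub>n-1\<^esub>\<close> and \<open>X\<close> the shift followed by multiplication with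
  \<open>q\<^sup>n\<close>. The recurrence of the numerators reads \<open>(1 - aX)(1 - bX) P = S(d + cX) P\<close> off the initial value,
  and \<open>XS = qSX\<close>; solving it by a geometric series gives a sum of \<open>S\<^sup>k\<close> applied to the following power
  series in \<open>X\<close>, and \<open>X\<^sup>n\<close> maps the unit sequence at 0 to \<open>q\<^bsup>n(n+1)/2\<^esup>\<close> times the one at \<open>n\<close>.\<close>

definition H1_fps ::
    "complex \<Rightarrow> complex \<Rightarrow> complex \<Rightarrow> complex \<Rightarrow> complex \<Rightarrow> nat \<Rightarrow> complex fps" where
  "H1_fps a b c d q k =
     fps_qpoch_inverse a q k * (fps_qpoch_hom d c q k * fps_qpoch_inverse b q k)"

lemma H1_fps_0:
  "(1 - fps_const a * fps_X) * ((1 - fps_const b * fps_X) * H1_fps a b c d q 0) = 1"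
proof -
  have "?thesis \<longleftrightarrow> ((1 - fps_const a * fps_X) * fps_qpoch_inverse a q 0) *
      ((1 - fps_const b * fps_X) * fps_qpoch_inverse b q 0) = 1"
    by (simp add: H1_fps_def fps_qpoch_hom_def mult_ac)
  then show ?thesis by (simp only: fps_qpoch_inverse_0 mult_1_left)
qed

text \<open>Each linear factor removes the last factor of one inverse product. The powers of
  \<open>q\<close> at the parameters arise from moving \<open>X\<close> past \<open>S^(k+1)\<close>
  on the left and past \<open>S^k\<close> on the right.\<close>

lemma H1_fps_Suc:
  "(1 - fps_const (a * q ^ Suc k) * fps_X) *
     ((1 - fps_const (b * q ^ Suc k) * fps_X) * H1_fps a b c d q (Suc k)) =
   (fps_const d + fps_const (c * q ^ k) * fps_X) * H1_fps a b c d q k"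
proof -
  have "(1 - fps_const (a * q ^ Suc k) * fps_X) *
      ((1 - fps_const (b * q ^ Suc k) * fps_X) * H1_fps a b c d q (Suc k)) =
    ((1 - fps_const (a * q ^ Suc k) * fps_X) * fps_qpoch_inverse a q (Suc k)) *
    ((1 - fps_const (b * q ^ Suc k) * fps_X) * fps_qpoch_inverse b q (Suc k)) *
    fps_qpoch_hom d c q (Suc k)"
    unfolding H1_fps_def by (simp only: mult_ac)
  also have "\<dots> = fps_qpoch_inverse a q k * fps_qpoch_inverse b q k * fps_qpoch_hom d c q (Suc k)"
    unfolding fps_qpoch_inverse_Suc ..
  finally show ?thesis
    by (simp add: H1_fps_def fps_qpoch_hom_def mult_ac)
qed

lemma fps_linear_mult_linear_mult:
  "(1 - fps_const x * fps_X) * ((1 - fps_const y * fps_X) * F) =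
    F - fps_const (x + y) * (fps_X * F) + fps_const (x * y) * (fps_X * (fps_X * F :: complex fps))"
  unfolding fps_const_add[symmetric] fps_const_mult[symmetric]
  by (simp only: algebra_simps mult_1_left mult_1_right)

text \<open>The entry at index \<open>M\<close> of the operator solution: the monomial
  \<open>X^n\<close> reaches index \<open>n\<close> with its triangular weight, and
  \<open>S^(M-n)\<close> carries it to \<open>M\<close>. Index \<open>M\<close> belongs to the
  numerator with index \<open>M + 1\<close>.\<close>

definition H1_coeff_sum ::
    "complex \<Rightarrow> complex \<Rightarrow> complex \<Rightarrow> complex \<Rightarrow> complex \<Rightarrow> nat \<Rightarrow> complex" where
  "H1_coeff_sum a b c d q M = (\<Sum>n\<le>M. q ^ (n * (n + 1) div 2) * H1_fps a b c d q (M - n) $ n)"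

text \<open>The operator \<open>X\<close> in coordinates. Raising \<open>n\<close> to
  \<open>n + 1\<close> adds \<open>n + 1\<close> to the triangular exponent, and
  \<open>(n + 1) + (M - n) = M + 1\<close> no longer depends on \<open>n\<close>.\<close>

lemma sum_shift_fps_X:
  fixes F :: "nat \<Rightarrow> complex fps"
  shows "(\<Sum>n\<le>Suc M. q ^ (n * (n + 1) div 2) * (q ^ (Suc M - n) * (fps_X * F (Suc M - n)) $ n)) =
    q ^ Suc M * (\<Sum>n\<le>M. q ^ (n * (n + 1) div 2) * F (M - n) $ n)"
proof -
  have shift: "q ^ (Suc n * (Suc n + 1) div 2) * (q ^ (M - n) * F (M - n) $ n) =
      q ^ Suc M * (q ^ (n * (n + 1) div 2) * F (M - n) $ n)" if "n \<le> M" for n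
  proof -
    have "q ^ Suc M = q ^ Suc n * q ^ (M - n)"
      using that by (simp flip: power_add)
    then show ?thesis by (simp only: triangle_Suc power_add mult_ac)
  qed
  have "(\<Sum>n\<le>M. q ^ (Suc n * (Suc n + 1) div 2) * (q ^ (M - n) * F (M - n) $ n)) =
      q ^ Suc M * (\<Sum>n\<le>M. q ^ (n * (n + 1) div 2) * F (M - n) $ n)"
    unfolding sum_distrib_left by (intro sum.cong refl shift) (rule atMost_iff[THEN iffD1])
  moreover have "(fps_X * G) $ 0 = 0" "(fps_X * G) $ Suc n = G $ n" for G :: "complex fps" and n
    by simp_all
  ultimately show ?thesis
    by (simp only: sum.atMost_Suc_shift diff_Suc_Suc mult_zero_right add_0_left)
qed

lemma sum_linear_combination:
  fixes f g h :: "nat \<Rightarrow> complex"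
  shows "(\<Sum>n\<in>A. e n * (x * f n - y * g n + h n)) =
    x * (\<Sum>n\<in>A. e n * f n) - y * (\<Sum>n\<in>A. e n * g n) + (\<Sum>n\<in>A. e n * h n)"
  unfolding sum_distrib_left sum_subtractf[symmetric] sum.distrib[symmetric]
  by (intro sum.cong refl) (simp only: algebra_simps)

text \<open>The functional equations of \<open>H1_fps\<close> are compared coefficientwise and
  summed with the triangular weights; each factor \<open>fps_X\<close> then becomes an index shift
  by \<open>sum_shift_fps_X\<close>.\<close>

lemma H1_coeff_sum_rec:
  "H1_coeff_sum a b c d q (Suc (Suc M)) =
     ((a + b) * q ^ (M + 2) + d) * H1_coeff_sum a b c d q (Suc M) +
     (c * q ^ Suc M - a * b * q ^ (2 * M + 3)) * H1_coeff_sum a b c d q M"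
proof -
  define W where "W = H1_fps a b c d q"
  define e where "e n = q ^ (n * (n + 1) div 2)" for n
  define P where "P = H1_coeff_sum a b c d q"
  have P: "P m = (\<Sum>n\<le>m. e n * W (m - n) $ n)" for m
    by (simp add: P_def H1_coeff_sum_def e_def W_def)
  let ?m = "Suc (Suc M)"
  let ?X = "fps_X :: complex fps"
  \<comment> \<open>The index \<open>n = M + 2\<close> belongs to \<open>H1_fps\<close> at 0, whose
    equation has right side 1 and hence no coefficient at a positive index. All other
    \<open>n\<close> use \<open>H1_fps_Suc\<close>.\<close>
  let ?B = "\<lambda>n. if n = ?m then 0 else
    d * W (Suc M - n) $ n + c * (q ^ (Suc M - n) * (?X * W (Suc M - n)) $ n)"
  have X_const: "?X * (fps_const x * F) = fps_const x * (?X * F)" for x F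
    by (rule mult.left_commute)
  have move: "x = y - z + u" if "x - y + z = u" for x y z u :: complex
    using that by (simp add: algebra_simps)
  have coeff: "W (?m - n) $ n = (a + b) * (q ^ (?m - n) * (?X * W (?m - n)) $ n)
      - a * b * (q ^ (?m - n) * (?X * (fps_const (q ^ (?m - n)) * (?X * W (?m - n)))) $ n) + ?B n"
    if "n \<le> ?m" for n
  proof (cases "n = ?m")
    case True
    have "(W 0 - fps_const (a + b) * (?X * W 0) + fps_const (a * b) * (?X * (?X * W 0))) $ n = 0"
      unfolding fps_linear_mult_linear_mult[symmetric] W_def H1_fps_0 by (simp add: True)
    then have "W 0 $ n - (a + b) * (?X * W 0) $ n + a * b * (?X * (?X * W 0)) $ n = 0"
      by (simp only: fps_add_nth fps_sub_nth fps_mult_left_const_nth)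
    from move[OF this] show ?thesis
      by (simp only: True diff_self_eq_0 power_0 fps_const_1_eq_1 mult_1_left simp_thms if_True)
  next
    case False
    define k where "k = Suc M - n"
    have k: "Suc M - n = k" "?m - n = Suc k"
      using that False by (simp_all add: k_def)
    have "W (Suc k) - fps_const (a * q ^ Suc k + b * q ^ Suc k) * (?X * W (Suc k))
        + fps_const (a * q ^ Suc k * (b * q ^ Suc k)) * (?X * (?X * W (Suc k)))
        = fps_const d * W k + fps_const (c * q ^ k) * (?X * W k)"
      unfolding fps_linear_mult_linear_mult[symmetric] W_def H1_fps_Suc
      by (simp only: distrib_right mult.assoc)
    from arg_cong[OF this, of "\<lambda>F. F $ n"]
    have "W (Suc k) $ n - (a * q ^ Suc k + b * q ^ Suc k) * (?X * W (Suc k)) $ n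
        + (a * q ^ Suc k * (b * q ^ Suc k)) * (?X * (?X * W (Suc k))) $ n
        = d * W k $ n + c * q ^ k * (?X * W k) $ n"
      by (simp only: fps_add_nth fps_sub_nth fps_mult_left_const_nth)
    from move[OF this] show ?thesis
      unfolding k X_const fps_mult_left_const_nth using False
      by (simp only: if_False distrib_right distrib_left mult_ac)
  qed
  have "P ?m = (\<Sum>n\<le>?m. e n * ((a + b) * (q ^ (?m - n) * (?X * W (?m - n)) $ n)
      - a * b * (q ^ (?m - n) * (?X * (fps_const (q ^ (?m - n)) * (?X * W (?m - n)))) $ n) + ?B n))"
    unfolding P by (intro sum.cong refl arg_cong2[of _ _ _ _ "(*)"] coeff) (rule atMost_iff[THEN iffD1])
  also have "\<dots> = (a + b) * (\<Sum>n\<le>?m. e n * (q ^ (?m - n) * (?X * W (?m - n)) $ n))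
      - a * b * (\<Sum>n\<le>?m. e n * (q ^ (?m - n) * (?X * (fps_const (q ^ (?m - n)) * (?X * W (?m - n)))) $ n))
      + (\<Sum>n\<le>?m. e n * ?B n)"
    by (rule sum_linear_combination)
  also have "(\<Sum>n\<le>?m. e n * (q ^ (?m - n) * (?X * W (?m - n)) $ n)) = q ^ ?m * P (Suc M)"
    unfolding P e_def by (rule sum_shift_fps_X)
  \<comment> \<open>The term with \<open>a * b\<close> is shifted twice; the inner constant power of
    \<open>q\<close> is the weight that the second shift consumes.\<close>
  also have "(\<Sum>n\<le>?m. e n * (q ^ (?m - n) * (?X * (fps_const (q ^ (?m - n)) * (?X * W (?m - n)))) $ n))
      = q ^ ?m * (\<Sum>n\<le>Suc M. e n * (q ^ (Suc M - n) * (?X * W (Suc M - n)) $ n))"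
    using sum_shift_fps_X[of q "Suc M" "\<lambda>k. fps_const (q ^ k) * (?X * W k)"]
    unfolding fps_mult_left_const_nth e_def .
  also have "(\<Sum>n\<le>Suc M. e n * (q ^ (Suc M - n) * (?X * W (Suc M - n)) $ n)) = q ^ Suc M * P M"
    unfolding P e_def by (rule sum_shift_fps_X)
  also have "(\<Sum>n\<le>?m. e n * ?B n) = (\<Sum>n\<le>Suc M. e n * 
      (d * W (Suc M - n) $ n + c * (q ^ (Suc M - n) * (?X * W (Suc M - n)) $ n)))"
    unfolding sum.atMost_Suc[of _ "Suc M"] by (simp del: sum.atMost_Suc)
  also have "\<dots> = d * P (Suc M) + c * (\<Sum>n\<le>Suc M. e n * (q ^ (Suc M - n) * (?X * W (Suc M - n)) $ n))"
    unfolding P by (simp only: distrib_left sum.distrib sum_distrib_left mult_ac)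
  also have "(\<Sum>n\<le>Suc M. e n * (q ^ (Suc M - n) * (?X * W (Suc M - n)) $ n)) = q ^ Suc M * P M"
    unfolding P e_def by (rule sum_shift_fps_X)
  finally have *: "P ?m = (a + b) * (q ^ ?m * P (Suc M)) - a * b * (q ^ ?m * (q ^ Suc M * P M))
      + (d * P (Suc M) + c * (q ^ Suc M * P M))" .
  have exp: "q ^ (2 * M + 3) = q ^ ?m * q ^ Suc M" "M + 2 = ?m"
    unfolding power_add[symmetric] by (rule arg_cong) simp_all
  show ?thesis
    unfolding exp P_def[symmetric] * by (simp only: algebra_simps)
qed

section \<open>Identification of the numerators and denominators\<close>

lemma H1_C_rec:
  "H1_C a b c d q (Suc (Suc n)) =
     ((a + b) * q ^ Suc n + d) * H1_C a b c d q (Suc n) +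
     (c * q ^ n - a * b * q ^ (2 * n + 1)) * H1_C a b c d q n"
  by (simp add: H1_C_def H1_alpha_def H1_beta_def)

lemma H1_D_rec:
  "H1_D a b c d q (Suc (Suc n)) =
     ((a + b) * q ^ Suc n + d) * H1_D a b c d q (Suc n) +
     (c * q ^ n - a * b * q ^ (2 * n + 1)) * H1_D a b c d q n"
  by (simp add: H1_D_def H1_alpha_def H1_beta_def)

lemma H1_initial:
  "H1_C a b c d q 0 = 0" "H1_C a b c d q (Suc 0) = 1"
  "H1_D a b c d q 0 = 1" "H1_D a b c d q (Suc 0) = 1"
  by (simp_all add: H1_C_def H1_D_def H1_alpha_def H1_beta_def)

text \<open>Scaling \<open>a\<close>, \<open>b\<close>, \<open>c\<close> by \<open>q\<close>
  advances the coefficients of the recurrence by one index, so both sides solve the same recurrence;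
  the first two values agree.\<close>

lemma H1_D_eq_C:
  "H1_D a b c d q (Suc M) =
     H1_C a b c d q (Suc M) + (c - a * b * q) * H1_C (a * q) (b * q) (c * q) d q M"
proof (induction M rule: induct_nat_012)
  case (ge2 M)
  then show ?case
    unfolding H1_D_rec[of a b c d q "Suc M"] H1_C_rec[of a b c d q "Suc M"]
      H1_C_rec[of "a * q" "b * q" "c * q" d q M]
    by (simp only: ge2) (simp add: algebra_simps)
qed (simp_all add: H1_initial H1_C_rec H1_D_rec)

lemma H1_C_eq_coeff_sum:
  "H1_C a b c d q (Suc M) = H1_coeff_sum a b c d q M"
proof (induction M rule: induct_nat_012)
  case 0
  have "H1_fps a b c d q 0 $ 0 = 1"
    using arg_cong[OF H1_fps_0, of "\<lambda>F. F $ 0" a b c d q] by (simp only: fps_linear_mult_nth fps_one_nth simp_thms if_True)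
  then show ?case
    by (simp add: H1_initial H1_coeff_sum_def)
next
  case 1
  \<comment> \<open>At index 1 the sum is \<open>d + q * (a + b)\<close>: the constant coefficient
    for \<open>k = 1\<close> is \<open>d\<close>, and the linear coefficient for
    \<open>k = 0\<close> is \<open>a + b\<close>.\<close>
  note F0 = arg_cong[OF H1_fps_0, of "\<lambda>F. F $ 0" a b c d q, unfolded fps_linear_mult_nth]
  note F1 = arg_cong[OF H1_fps_0, of "\<lambda>F. F $ Suc 0" a b c d q, unfolded fps_linear_mult_nth F0]
  have "H1_fps a b c d q (Suc 0) $ 0 = d"
    using arg_cong[OF H1_fps_Suc, of "\<lambda>F. F $ 0" a q 0 b c d] F0
    unfolding fps_linear_mult_nth by simp
  then show ?case using F1
    by (simp add: H1_C_rec H1_initial H1_coeff_sum_def algebra_simps)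
next
  case (ge2 M)
  show ?case
    unfolding H1_coeff_sum_rec H1_C_rec[of _ _ _ _ _ "Suc M"] ge2 by (simp add: eval_nat_numeral)
qed

lemma H1_fps_nth:
  assumes q: "norm q < 1"
  shows "H1_fps a b c d q k $ n = (\<Sum>j\<le>n. \<Sum>l\<le>n - j.
    a ^ j * gauss_binom q (int (k + j)) (int j) *
    (c ^ l * d ^ (k - l) * q ^ (l * (l - 1) div 2) * gauss_binom q (int k) (int l) *
     (b ^ (n - j - l) * gauss_binom q (int (k + (n - j - l))) (int (n - j - l)))))"
  unfolding H1_fps_def fps_mult_nth fps_qpoch_inverse_nth[OF q] fps_qpoch_hom_nth[OF q]
    atLeast0AtMost sum_distrib_left ..

text \<open>The sum has finite support: for \<open>n > M\<close> the first Gaussian polynomial is 0,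
  and for \<open>j + l > n\<close> the second one is. On the remaining indices it is the Cauchy
  product of the three \<open>q\<close>-binomial expansions.\<close>

lemma H1_C_triple_sum:
  assumes q: "norm q < 1"
  shows "H1_C a b c d q (Suc M) = (\<Sum>\<^sub>\<infinity>(j, l, n)\<in>(UNIV :: (nat \<times> nat \<times> nat) set).
     a ^ j * b powi (int n - int j - int l) * c ^ l * d powi (int M - int n - int l) *
     q ^ (n * (n + 1) div 2 + l * (l - 1) div 2) *
     gauss_binom q (int M - int n + int j) (int j) *
     gauss_binom q (int M - int j - int l) (int n - int j - int l) *
     gauss_binom q (int M - int n) (int l))"
    (is "_ = infsum ?f UNIV")
proof -
  define I where "I = (SIGMA n:{..M}. SIGMA j:{..n}. {..n - j})"
  define h where "h = (\<lambda>(n, j, l). (j, l, n) :: nat \<times> nat \<times> nat)"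
  have fin: "finite I" by (auto simp: I_def)
  have "infsum ?f UNIV = infsum ?f (h ` I)"
  proof (rule infsum_cong_neutral)
    fix x :: "nat \<times> nat \<times> nat" assume x: "x \<in> UNIV - h ` I"
    obtain j l n where [simp]: "x = (j, l, n)" by (cases x)
    have "(n, j, l) \<notin> I" using x by (force simp: h_def)
    then have "n > M \<or> j + l > n" by (auto simp: I_def)
    then show "?f x = 0" by (auto simp: gauss_binom_def)
  qed auto
  also have "\<dots> = sum ?f (h ` I)" using fin by simp
  also have "\<dots> = (\<Sum>x\<in>I. ?f (h x))"
    by (subst sum.reindex) (auto simp: h_def inj_on_def)
  also have "\<dots> = (\<Sum>n\<le>M. \<Sum>j\<le>n. \<Sum>l\<le>n - j. ?f (h (n, j, l)))"
    unfolding I_def by (simp add: sum.Sigma)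
  also have "\<dots> = (\<Sum>n\<le>M. \<Sum>j\<le>n. \<Sum>l\<le>n - j. q ^ (n * (n + 1) div 2) *
    (a ^ j * gauss_binom q (int (M - n + j)) (int j) *
    (c ^ l * d ^ (M - n - l) * q ^ (l * (l - 1) div 2) * gauss_binom q (int (M - n)) (int l) *
     (b ^ (n - j - l) * gauss_binom q (int (M - n + (n - j - l))) (int (n - j - l))))))"
  proof (intro sum.cong refl)
    fix n j l assume "n \<in> {..M}" "j \<in> {..n}" "l \<in> {..n - j}"
    then have le: "n \<le> M" "j + l \<le> n" by auto
    have eqs: "int M - int n = int (M - n)" "int M - int n + int j = int (M - n + j)"
      "int M - int j - int l = int (M - n + (n - j - l))" "int n - int j - int l = int (n - j - l)"
      using le by auto
    \<comment> \<open>For \<open>l > M - n\<close> the integer exponent is negative and the natural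
      one is truncated to 0, but the third Gaussian polynomial vanishes.\<close>
    have dpow: "d powi (int M - int n - int l) * gauss_binom q (int (M - n)) (int l) =
        d ^ (M - n - l) * gauss_binom q (int (M - n)) (int l)"
    proof (cases "l \<le> M - n")
      case True
      then have "int M - int n - int l = int (M - n - l)" using le by auto
      then show ?thesis by (simp only: power_int_of_nat)
    qed (simp add: gauss_binom_def)
    show "?f (h (n, j, l)) = q ^ (n * (n + 1) div 2) *
      (a ^ j * gauss_binom q (int (M - n + j)) (int j) *
      (c ^ l * d ^ (M - n - l) * q ^ (l * (l - 1) div 2) * gauss_binom q (int (M - n)) (int l) *
       (b ^ (n - j - l) * gauss_binom q (int (M - n + (n - j - l))) (int (n - j - l)))))"
    proof -
      have "?f (h (n, j, l)) = a ^ j * b ^ (n - j - l) * c ^ l * q ^ (n * (n + 1) div 2) *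
          q ^ (l * (l - 1) div 2) * gauss_binom q (int (M - n + j)) (int j) *
          gauss_binom q (int (M - n + (n - j - l))) (int (n - j - l)) *
          (d powi (int M - int n - int l) * gauss_binom q (int (M - n)) (int l))"
        unfolding h_def prod.case eqs(2-4) power_add power_int_of_nat
        by (simp only: eqs(1) mult_ac)
      then show ?thesis unfolding dpow by (simp only: mult_ac)
    qed
  qed
  also have "\<dots> = H1_coeff_sum a b c d q M"
    unfolding H1_coeff_sum_def H1_fps_nth[OF q] sum_distrib_left ..
  finally show ?thesis unfolding H1_C_eq_coeff_sum ..
qed

section \<open>Convergence\<close>

text \<open>This undoes the contraction in \<open>qseries\<close>: once no factor vanishes, dividing
  by the infinite product restores the finite products in the denominators.\<close>

lemma qseries_divide_sums:
  assumes q: "norm q < 1" and nz: "\<And>k. 1 + a * q ^ (s + k) \<noteq> 0"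
  shows "(\<lambda>j. qseries_coeff b c q j * q ^ (j * r) / qpoch (- a * q ^ s) q j)
    sums (qseries a b c q r s / qpoch_inf (- a * q ^ s) q)"
proof -
  have nz': "1 - - a * q ^ s * q ^ k \<noteq> 0" for k
    using nz[of k] by (simp add: power_add mult.assoc)
  have inf_nz: "qpoch_inf (- a * q ^ s) q \<noteq> 0"
    by (rule qpoch_inf_nonzero[OF q nz'])
  have "qpoch_inf (- a * q ^ (j + s)) q / qpoch_inf (- a * q ^ s) q = 1 / qpoch (- a * q ^ s) q j" for j
  proof -
    have "- a * q ^ s * q ^ j = - a * q ^ (j + s)" by (simp add: power_add mult_ac)
    then have "qpoch_inf (- a * q ^ s) q = qpoch (- a * q ^ s) q j * qpoch_inf (- a * q ^ (j + s)) q"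
      using qpoch_inf_split[OF q, of "- a * q ^ s" j] by (simp only:)
    then show ?thesis using inf_nz by (auto simp: divide_simps)
  qed
  then have "qseries_coeff b c q j * q ^ (j * r) * qpoch_inf (- a * q ^ (j + s)) q / qpoch_inf (- a * q ^ s) q
      = qseries_coeff b c q j * q ^ (j * r) / qpoch (- a * q ^ s) q j" for j
    by (metis times_divide_eq_right mult.right_neutral)
  with sums_divide[OF qseries_sums[OF q, of b c r a s], of "qpoch_inf (- a * q ^ s) q"]
  show ?thesis by (simp only:)
qed

section \<open>Limits of the normalized convergents\<close>

context
  fixes a b c d q :: complex
  assumes d: "d \<noteq> 0" and q: "norm q < 1"
begin

definition "normalized_C n = H1_C a b c d q n / d ^ n"
definition "normalized_D n = H1_D a b c d q n / d ^ n"
definition "normalized_alpha n = c / d ^ 2 * q ^ n - a / d * (b / d) * q ^ (2 * n + 1)"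
definition "normalized_beta n = 1 + (a / d + b / d) * q ^ Suc n"
text \<open>The adjoint solution \<open>T\<close>. Division by \<open>d ^ n\<close> replaces
  \<open>(a, b, c, d)\<close> by \<open>(a/d, b/d, c/d^2, 1)\<close>, so the series is taken at
  these parameters.\<close>

definition "H1_tail n = qseries (a / d) (b / d) (c / d ^ 2) q n (Suc n)"

lemma normalize_rec:
  "((((a + b) * q ^ Suc n + d) * x + (c * q ^ n - a * b * q ^ (2 * n + 1)) * y) / d ^ Suc (Suc n)) =
    normalized_beta n * (x / d ^ Suc n) + normalized_alpha n * (y / d ^ n)"
proof -
  have "normalized_beta n = ((a + b) * q ^ Suc n + d) / d"
    using d unfolding normalized_beta_def by (simp add: field_simps)
  moreover have "normalized_alpha n = (c * q ^ n - a * b * q ^ (2 * n + 1)) / d ^ 2"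
    unfolding normalized_alpha_def by (simp add: diff_divide_distrib power2_eq_square)
  ultimately show ?thesis
    by (simp only: times_divide_times_eq power_Suc power2_eq_square mult.assoc)
      (simp only: add_divide_distrib)
qed

lemma normalized_C_rec:
  "normalized_C (Suc (Suc n)) = normalized_beta n * normalized_C (Suc n) + normalized_alpha n * normalized_C n"
  unfolding normalized_C_def H1_C_rec by (rule normalize_rec)

lemma normalized_D_rec:
  "normalized_D (Suc (Suc n)) = normalized_beta n * normalized_D (Suc n) + normalized_alpha n * normalized_D n"
  unfolding normalized_D_def H1_D_rec by (rule normalize_rec)

lemma H1_tail_rec: "H1_tail n = normalized_beta n * H1_tail (Suc n) + normalized_alpha (Suc n) * H1_tail (Suc (Suc n))"
proof -
  have "n + 2 = Suc (Suc n)" "n + 3 = Suc (Suc (Suc n))" by simp_all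
  then show ?thesis
    using qseries_diagonal_recurrence[OF q, of "a / d" "b / d" "c / d ^ 2" n]
    unfolding H1_tail_def normalized_beta_def normalized_alpha_def by (simp only:)
qed

lemma H1_tail_tendsto_1: "H1_tail \<longlonglongrightarrow> 1"
  unfolding H1_tail_def by (rule qseries_diagonal_tendsto_1[OF q])

lemma normalized_alpha_tendsto_0: "normalized_alpha \<longlonglongrightarrow> 0"
proof -
  have "(\<lambda>n. c / d ^ 2 * q ^ n - a / d * (b / d) * (q * (q ^ n) ^ 2))
      \<longlonglongrightarrow> c / d ^ 2 * 0 - a / d * (b / d) * (q * 0 ^ 2)"
    by (intro tendsto_intros LIMSEQ_power_zero q)
  then show ?thesis
    unfolding normalized_alpha_def[abs_def] by (simp add: power_even_eq)
qed

lemma normalized_C_tendsto: "normalized_C \<longlonglongrightarrow> H1_tail 0 / d"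
  using three_term_tendsto[OF normalized_C_rec H1_tail_rec H1_tail_tendsto_1 normalized_alpha_tendsto_0]
  by (simp add: normalized_C_def[of 0] normalized_C_def[of "Suc 0"] H1_initial)

lemma normalized_D_tendsto: "normalized_D \<longlonglongrightarrow> H1_tail 0 / d + (c - a * b * q) / d ^ 2 * H1_tail 1"
  using three_term_tendsto[OF normalized_D_rec H1_tail_rec H1_tail_tendsto_1 normalized_alpha_tendsto_0]
  by (simp add: normalized_D_def[of 0] normalized_D_def[of "Suc 0"] normalized_alpha_def[of 0] H1_initial
      diff_divide_distrib power2_eq_square)

lemma H1_converges_to_Some_iff:
  "H1_converges_to a b c d q (Some v) \<longleftrightarrow>
     (\<forall>\<^sub>F n in sequentially. normalized_D n \<noteq> 0) \<and> (\<lambda>n. normalized_C n / normalized_D n) \<longlonglongrightarrow> v"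
  using d by (simp add: H1_converges_to_def cf_converges_to_def normalized_C_def normalized_D_def
      H1_C_def H1_D_def)

lemma H1_converges_to_None_iff:
  "H1_converges_to a b c d q None \<longleftrightarrow>
     (\<forall>\<^sub>F n in sequentially. normalized_C n \<noteq> 0) \<and> (\<lambda>n. normalized_D n / normalized_C n) \<longlonglongrightarrow> 0"
  using d by (simp add: H1_converges_to_def cf_converges_to_def normalized_C_def normalized_D_def
      H1_C_def H1_D_def)

text \<open>The two alternatives for the ratio of two solutions are convergence to a finite value
  and convergence to the point at infinity.\<close>

lemma H1_converges:
  assumes "\<exists>\<^sub>F N in sequentially. H1_C a b c d q N \<noteq> 0 \<or> H1_D a b c d q N \<noteq> 0"
  shows "\<exists>h. H1_converges_to a b c d q h"
proof -
  have "\<exists>\<^sub>F n in sequentially. normalized_C n \<noteq> 0 \<or> normalized_D n \<noteq> 0"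
    using assms d by (simp add: normalized_C_def normalized_D_def)
  from three_term_ratio_converges[OF normalized_C_rec normalized_D_rec H1_tail_rec H1_tail_tendsto_1
      normalized_alpha_tendsto_0 this]
  show ?thesis
    unfolding H1_converges_to_Some_iff[symmetric] H1_converges_to_None_iff[symmetric] by blast
qed

text \<open>The numerators have a nonzero limit, so the reciprocal convergents always converge. If
  the denominators tend to 0, the fraction is infinite and its inverse is 0.\<close>

lemma H1_converges_to_limit:
  assumes "H1_tail 0 \<noteq> 0"
  shows "\<exists>h. H1_converges_to a b c d q h \<and>
    sphere_inverse h = Some (1 + (c - a * b * q) / d * (H1_tail 1 / H1_tail 0))"
proof -
  let ?L = "H1_tail 0 / d + (c - a * b * q) / d ^ 2 * H1_tail 1"
  have w: "?L / (H1_tail 0 / d) = 1 + (c - a * b * q) / d * (H1_tail 1 / H1_tail 0)"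
    using assms d by (simp add: divide_simps power2_eq_square)
  have C: "H1_tail 0 / d \<noteq> 0" using assms d by simp
  show ?thesis
  proof (cases "?L = 0")
    case True
    have "(\<lambda>n. normalized_D n / normalized_C n) \<longlonglongrightarrow> ?L / (H1_tail 0 / d)"
      by (intro tendsto_divide normalized_C_tendsto normalized_D_tendsto C)
    then have "H1_converges_to a b c d q None"
      unfolding H1_converges_to_None_iff True
      using tendsto_imp_eventually_ne[OF normalized_C_tendsto C] by simp
    then show ?thesis
      using w unfolding True by (intro exI[of _ None]) (simp add: sphere_inverse_def)
  next
    case False
    have "H1_converges_to a b c d q (Some (H1_tail 0 / d / ?L))"
      unfolding H1_converges_to_Some_iff
      by (intro conjI tendsto_divide normalized_C_tendsto normalized_D_tendsto False
          tendsto_imp_eventually_ne[OF normalized_D_tendsto])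
    moreover have "sphere_inverse (Some (H1_tail 0 / d / ?L)) = Some (?L / (H1_tail 0 / d))"
      using C False unfolding sphere_inverse_def by simp
    ultimately show ?thesis
      unfolding w by blast
  qed
qed

lemma H1_converges_to_0:
  assumes "H1_tail 0 = 0" and "(c - a * b * q) * H1_tail 1 \<noteq> 0"
  shows "H1_converges_to a b c d q (Some 0)"
proof -
  have lim: "normalized_D \<longlonglongrightarrow> (c - a * b * q) / d ^ 2 * H1_tail 1"
    using normalized_D_tendsto assms(1) by simp
  have nz: "(c - a * b * q) / d ^ 2 * H1_tail 1 \<noteq> 0" using assms(2) d by simp
  have "(\<lambda>n. normalized_C n / normalized_D n) \<longlonglongrightarrow> H1_tail 0 / d / ((c - a * b * q) / d ^ 2 * H1_tail 1)"
    by (intro tendsto_divide normalized_C_tendsto lim nz)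
  then show ?thesis
    unfolding H1_converges_to_Some_iff using tendsto_imp_eventually_ne[OF lim nz] by (simp add: assms(1))
qed

lemma H1_tail_0_sums:
  assumes "\<And>k. d + a * q ^ (k + 1) \<noteq> 0"
  shows "(\<lambda>j. qpoch_hom (b / d) (c / d ^ 2) q j * q ^ (j * (j + 1) div 2) /
      (qpoch q q j * qpoch (- a * q / d) q j)) sums (H1_tail 0 / qpoch_inf (- a * q / d) q)"
proof -
  have "1 + a / d * q ^ (1 + k) \<noteq> 0" for k
    using assms[of k] d by (simp add: divide_simps)
  from qseries_divide_sums[OF q this, of "b / d" "c / d ^ 2" 0] show ?thesis
    by (simp add: H1_tail_def qseries_coeff_def mult_ac)
qed

text \<open>The series with \<open>r = 1\<close> carries \<open>q ^ j\<close>; the extra factor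
  \<open>q\<close> completes the triangular exponent to
  \<open>(j + 1) * (j + 2) div 2\<close>.\<close>

lemma H1_tail_1_sums:
  assumes "\<And>k. d + a * q ^ (k + 1) \<noteq> 0"
  shows "(\<lambda>j. qpoch_hom (b / d) (c / d ^ 2) q j * q ^ ((j + 1) * (j + 2) div 2) /
      (qpoch q q j * qpoch (- a * q ^ 2 / d) q j)) sums (q * H1_tail 1 / qpoch_inf (- a * q ^ 2 / d) q)"
proof -
  have "1 + a / d * q ^ (2 + k) \<noteq> 0" for k
    using assms[of "Suc k"] d by (simp add: divide_simps)
  from sums_mult[OF qseries_divide_sums[OF q this, of "b / d" "c / d ^ 2" 1], of q]
  have "(\<lambda>j. q * (qseries_coeff (b / d) (c / d ^ 2) q j * q ^ (j * 1) / qpoch (- (a / d) * q ^ 2) q j))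
      sums (q * H1_tail 1 / qpoch_inf (- (a / d) * q ^ 2) q)"
    by (simp add: H1_tail_def numeral_2_eq_2)
  moreover have "q * (qseries_coeff (b / d) (c / d ^ 2) q j * q ^ (j * 1) / qpoch (- (a / d) * q ^ 2) q j) =
      qpoch_hom (b / d) (c / d ^ 2) q j * q ^ ((j + 1) * (j + 2) div 2) /
      (qpoch q q j * qpoch (- a * q ^ 2 / d) q j)" for j
  proof -
    have "(j + 1) * (j + 2) div 2 = j * (j + 1) div 2 + Suc j"
      using triangle_Suc[of j] by simp
    then show ?thesis by (simp add: qseries_coeff_def power_add)
  qed
  ultimately show ?thesis by simp
qed

lemma qpoch_inf_scaled_split:
  "qpoch_inf (- a * q / d) q = (1 + a * q / d) * qpoch_inf (- a * q ^ 2 / d) q"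
  using qpoch_inf_Suc[OF q, of "a / d" 1] by (simp add: numeral_2_eq_2)

lemma qpoch_inf_scaled_nonzero:
  assumes "\<And>k. d + a * q ^ (k + 1) \<noteq> 0"
  shows "qpoch_inf (- a * q / d) q \<noteq> 0"
proof (rule qpoch_inf_nonzero[OF q])
  fix k show "1 - - a * q / d * q ^ k \<noteq> 0"
    using assms[of k] d by (simp add: divide_simps mult_ac)
qed

end

section \<open>The formulas in the form of the theorem\<close>

lemma H1_C_sum_formula:
  assumes d: "d \<noteq> 0" and q: "norm q < 1" and N: "N \<ge> 1"
  shows "H1_C a b c d q N = d ^ (N - 1) *
    (\<Sum>\<^sub>\<infinity>(j, l, n)\<in>(UNIV :: (nat \<times> nat \<times> nat) set).
       a ^ j * b powi (int n - int j - int l) * c ^ l * d powi (- int n - int l) *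
       q ^ (n * (n + 1) div 2 + l * (l - 1) div 2) *
       gauss_binom q (int N - 1 - int n + int j) (int j) *
       gauss_binom q (int N - 1 - int j - int l) (int n - int j - int l) *
       gauss_binom q (int N - 1 - int n) (int l))"
proof -
  obtain M where M: "N = Suc M" using N by (cases N) auto
  have int_N: "int N - 1 = int M" "N - 1 = M" by (simp_all add: M)
  have dpow: "d powi (int M - int n - int l) = d ^ M * d powi (- int n - int l)" for n l
  proof -
    have "d powi (int M - int n - int l) = d powi (int M + (- int n - int l))"
      by (rule arg_cong) simp
    then show ?thesis using d by (simp only: power_int_add simp_thms power_int_of_nat)
  qed
  show ?thesis
    unfolding int_N unfolding M H1_C_triple_sum[OF q] infsum_cmult_right'[symmetric]
  proof (rule infsum_cong)
    fix x :: "nat \<times> nat \<times> nat"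
    show "(case x of (j, l, n) \<Rightarrow> a ^ j * b powi (int n - int j - int l) * c ^ l *
          d powi (int M - int n - int l) * q ^ (n * (n + 1) div 2 + l * (l - 1) div 2) *
          gauss_binom q (int M - int n + int j) (int j) *
          gauss_binom q (int M - int j - int l) (int n - int j - int l) *
          gauss_binom q (int M - int n) (int l)) =
      d ^ M * (case x of (j, l, n) \<Rightarrow> a ^ j * b powi (int n - int j - int l) * c ^ l *
          d powi (- int n - int l) * q ^ (n * (n + 1) div 2 + l * (l - 1) div 2) *
          gauss_binom q (int M - int n + int j) (int j) *
          gauss_binom q (int M - int j - int l) (int n - int j - int l) *
          gauss_binom q (int M - int n) (int l))"
      by (cases x) (simp only: prod.case dpow mult_ac)
  qed
qed

text \<open>By \<open>H1_D_eq_C\<close> the sum comes from a numerator at \<open>a * q\<close>,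
  \<open>b * q\<close>, \<open>c * q\<close>. The powers of \<open>q\<close> so gained multiply to
  \<open>q ^ n\<close>, and one more \<open>q\<close>, taken from \<open>c - a * b * q\<close>,
  moves the triangular exponent to the next one.\<close>

lemma H1_D_sum_formula:
  assumes q: "norm q < 1" and N: "N \<ge> 2" and q0: "q \<noteq> 0"
  shows "H1_D a b c d q N = H1_C a b c d q N + (c / q - a * b) *
    (\<Sum>\<^sub>\<infinity>(j, l, n)\<in>(UNIV :: (nat \<times> nat \<times> nat) set).
       a ^ j * b powi (int n - int j - int l) * c ^ l *
       d powi (int N - 2 - int n - int l) *
       q ^ ((n + 1) * (n + 2) div 2 + l * (l - 1) div 2) *
       gauss_binom q (int N - 2 - int n + int j) (int j) *
       gauss_binom q (int N - 2 - int j - int l) (int n - int j - int l) *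
       gauss_binom q (int N - 2 - int n) (int l))"
    (is "_ = _ + _ * infsum ?f UNIV")
proof -
  obtain M where M: "N = Suc (Suc M)" using N by (cases N; cases "N - 1") auto
  have int_N: "int N - 2 = int M" by (simp add: M)
  let ?g = "\<lambda>(j, l, n). (a * q) ^ j * (b * q) powi (int n - int j - int l) * (c * q) ^ l *
       d powi (int M - int n - int l) * q ^ (n * (n + 1) div 2 + l * (l - 1) div 2) *
       gauss_binom q (int M - int n + int j) (int j) *
       gauss_binom q (int M - int j - int l) (int n - int j - int l) *
       gauss_binom q (int M - int n) (int l)"
  have "infsum ?f UNIV = infsum (\<lambda>x. q * ?g x) UNIV"
  proof (rule infsum_cong)
    fix x :: "nat \<times> nat \<times> nat"
    obtain j l n where x: "x = (j, l, n)" by (cases x)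
    show "?f x = q * ?g x"
    proof (cases "j + l \<le> n")
      case True
      have "int n - int j - int l = int (n - j - l)" using True by simp
      then have b: "(b * q) powi (int n - int j - int l) =
          b powi (int n - int j - int l) * q ^ (n - j - l)"
        by (simp only: power_int_of_nat power_mult_distrib)
      have "(n + 1) * (n + 2) div 2 = n * (n + 1) div 2 + Suc n"
        using triangle_Suc[of n] by simp
      also have "Suc n = Suc (j + l + (n - j - l))" using True by simp
      finally have e: "q ^ ((n + 1) * (n + 2) div 2) =
          q ^ (n * (n + 1) div 2) * (q * (q ^ j * q ^ l * q ^ (n - j - l)))"
        by (simp only: power_add power_Suc)
      show ?thesis
        unfolding x prod.case int_N b power_mult_distrib power_add e by (simp only: mult_ac)
    qed (simp add: x gauss_binom_def)
  qed
  also have "\<dots> = q * H1_C (a * q) (b * q) (c * q) d q (Suc M)"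
    unfolding H1_C_triple_sum[OF q] by (rule infsum_cmult_right')
  finally have "(c / q - a * b) * infsum ?f UNIV =
      (c - a * b * q) * H1_C (a * q) (b * q) (c * q) d q (Suc M)"
    using q0 by (simp add: field_simps)
  then show ?thesis
    unfolding M H1_D_eq_C[of a b c d q "Suc M"] by (simp only:)
qed

lemma H1_D_sum_formula':
  assumes q: "norm q < 1" and N: "N \<ge> 2" and q0: "q \<noteq> 0" and b: "b \<noteq> 0"
  shows "H1_D a b c d q N = H1_C a b c d q N + (c / (b * q) - a) *
    (\<Sum>\<^sub>\<infinity>(j, l, n)\<in>(UNIV :: (nat \<times> nat \<times> nat) set).
       a ^ j * b powi (int n + 1 - int j - int l) * c ^ l *
       d powi (int N - 2 - int n - int l) *
       q ^ ((n + 1) * (n + 2) div 2 + l * (l - 1) div 2) *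
       gauss_binom q (int N - 2 - int n + int j) (int j) *
       gauss_binom q (int N - 2 - int j - int l) (int n - int j - int l) *
       gauss_binom q (int N - 2 - int n) (int l))"
    (is "_ = _ + _ * infsum ?f UNIV")
proof -
  let ?g = "\<lambda>(j, l, n). a ^ j * b powi (int n - int j - int l) * c ^ l *
       d powi (int N - 2 - int n - int l) *
       q ^ ((n + 1) * (n + 2) div 2 + l * (l - 1) div 2) *
       gauss_binom q (int N - 2 - int n + int j) (int j) *
       gauss_binom q (int N - 2 - int j - int l) (int n - int j - int l) *
       gauss_binom q (int N - 2 - int n) (int l)"
  have "infsum ?f UNIV = infsum (\<lambda>x. b * ?g x) UNIV"
  proof (rule infsum_cong)
    fix x :: "nat \<times> nat \<times> nat"
    obtain j l n where x: "x = (j, l, n)" by (cases x)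
    have "b powi (int n + 1 - int j - int l) = b powi ((int n - int j - int l) + 1)"
      by (rule arg_cong) simp
    then have e: "b powi (int n + 1 - int j - int l) = b * b powi (int n - int j - int l)"
      using b by (simp only: power_int_add_1 mult.commute simp_thms)
    show "?f x = b * ?g x"
      unfolding x prod.case e by (simp only: mult_ac)
  qed
  also have "\<dots> = b * infsum ?g UNIV" by (rule infsum_cmult_right')
  finally have "(c / (b * q) - a) * infsum ?f UNIV = (c / q - a * b) * infsum ?g UNIV"
    using b q0 by (simp add: field_simps)
  then show ?thesis
    unfolding H1_D_sum_formula[OF q N q0] by (simp only:)
qed

text \<open>Both series are values of \<open>H1_tail\<close> divided by infinite products that
  differ only in the factor \<open>1 + a * q / d\<close>; this is the origin of
  \<open>d + a * q\<close> in the denominator.\<close>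

lemma H1_inverse_value:
  fixes a b c d q :: complex
  assumes d: "d \<noteq> 0" and q: "norm q < 1" and q0: "q \<noteq> 0"
    and nz: "\<And>k. d + a * q ^ (k + 1) \<noteq> 0"
  defines "S1 \<equiv> \<Sum>j. qpoch_hom (b / d) (c / d ^ 2) q j * q ^ ((j + 1) * (j + 2) div 2) /
      (qpoch q q j * qpoch (- a * q ^ 2 / d) q j)"
    and "S0 \<equiv> \<Sum>j. qpoch_hom (b / d) (c / d ^ 2) q j * q ^ (j * (j + 1) div 2) /
      (qpoch q q j * qpoch (- a * q / d) q j)"
  shows "S0 \<noteq> 0 \<Longrightarrow> \<exists>h w. H1_converges_to a b c d q h \<and> sphere_inverse h = Some w \<and>
      w - 1 = (c - a * b * q) / ((d + a * q) * q) * (S1 / S0)"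
    and "S0 = 0 \<Longrightarrow> (c - a * b * q) * S1 \<noteq> 0 \<Longrightarrow> H1_converges_to a b c d q (Some 0)"
proof -
  define T0 where "T0 = H1_tail a b c d q 0"
  define T1 where "T1 = H1_tail a b c d q 1"
  define u where "u = qpoch_inf (- a * q ^ 2 / d) q"
  have dq: "d + a * q \<noteq> 0" using nz[of 0] by simp
  have u1: "qpoch_inf (- a * q / d) q = (1 + a * q / d) * u"
    unfolding u_def by (rule qpoch_inf_scaled_split[OF d q])
  have u: "u \<noteq> 0"
    using qpoch_inf_scaled_nonzero[OF d q nz] u1 by auto
  have S0: "S0 = T0 / ((1 + a * q / d) * u)"
    using H1_tail_0_sums[OF d q nz] unfolding S0_def T0_def u1[symmetric] by (rule sums_unique[symmetric])
  have S1: "S1 = q * T1 / u"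
    using H1_tail_1_sums[OF d q nz] unfolding S1_def T1_def u_def by (rule sums_unique[symmetric])
  show "\<exists>h w. H1_converges_to a b c d q h \<and> sphere_inverse h = Some w \<and>
      w - 1 = (c - a * b * q) / ((d + a * q) * q) * (S1 / S0)" if "S0 \<noteq> 0"
  proof -
    have T0: "T0 \<noteq> 0" using that S0 by auto
    have "S1 / S0 = q * (d + a * q) / d * (T1 / T0)"
      using d u dq T0 unfolding S0 S1 by (simp add: divide_simps)
    then have "(c - a * b * q) / ((d + a * q) * q) * (S1 / S0) = (c - a * b * q) / d * (T1 / T0)"
      using d q0 dq by simp
    with H1_converges_to_limit[OF d q, of a b c] T0 show ?thesis
      unfolding T0_def T1_def by auto
  qed
  show "H1_converges_to a b c d q (Some 0)" if "S0 = 0" "(c - a * b * q) * S1 \<noteq> 0"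
  proof (rule H1_converges_to_0[OF d q])
    have "(1 + a * q / d) * u \<noteq> 0"
      using d dq u by (simp add: divide_simps)
    then show "H1_tail a b c d q 0 = 0"
      using that(1) unfolding S0 T0_def[symmetric] by simp
    show "(c - a * b * q) * H1_tail a b c d q 1 \<noteq> 0"
      using that(2) unfolding S1 T1_def[symmetric] by auto
  qed
qed

text \<open>For \<open>d = 1\<close> the normalization is trivial, so the normalized limits are
  those of the convergents themselves.\<close>

lemma H1_limits:
  assumes q: "norm q < 1"
  shows "H1_C a b c 1 q \<longlonglongrightarrow> H1_tail a b c 1 q 0"
    and "H1_D a b c 1 q \<longlonglongrightarrow> H1_tail a b c 1 q 0 + (c - a * b * q) * H1_tail a b c 1 q 1"
proof -
  have one: "(1::complex) \<noteq> 0" by simp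
  have "normalized_C a b c 1 q = H1_C a b c 1 q" "normalized_D a b c 1 q = H1_D a b c 1 q"
    using normalized_C_def[OF one q] normalized_D_def[OF one q] by (auto simp: fun_eq_iff)
  then show "H1_C a b c 1 q \<longlonglongrightarrow> H1_tail a b c 1 q 0"
    and "H1_D a b c 1 q \<longlonglongrightarrow> H1_tail a b c 1 q 0 + (c - a * b * q) * H1_tail a b c 1 q 1"
    using normalized_C_tendsto[OF one q, of a b c] normalized_D_tendsto[OF one q, of a b c]
    by simp_all
qed

lemma H1_limit_values:
  assumes q: "norm q < 1" and nz: "\<And>k. 1 + a * q ^ (k + 1) \<noteq> 0"
  shows "lim (H1_C a b c 1 q) = qpoch_inf (- a * q) q *
      (\<Sum>j. q ^ (j * (j + 1) div 2) * qpoch_hom b c q j / (qpoch q q j * qpoch (- a * q) q j))"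
    and "q \<noteq> 0 \<Longrightarrow> lim (H1_D a b c 1 q) = lim (H1_C a b c 1 q) +
      (c / q - a * b) * qpoch_inf (- a * q) q *
      (\<Sum>j. q ^ ((j + 1) * (j + 2) div 2) * qpoch_hom b c q j / (qpoch q q j * qpoch (- a * q) q (j + 1)))"
proof -
  define u where "u = qpoch_inf (- a * q ^ 2) q"
  have one: "(1::complex) \<noteq> 0" by simp
  have aq: "1 + a * q \<noteq> 0" using nz[of 0] by simp
  have u1: "qpoch_inf (- a * q) q = (1 + a * q) * u"
    using qpoch_inf_scaled_split[OF one q, of a] by (simp add: u_def)
  have u1_nz: "qpoch_inf (- a * q) q \<noteq> 0"
    using qpoch_inf_scaled_nonzero[OF one q nz] by simp
  then have u: "u \<noteq> 0" using u1 by auto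
  have "(\<lambda>j. q ^ (j * (j + 1) div 2) * qpoch_hom b c q j / (qpoch q q j * qpoch (- a * q) q j))
      sums (H1_tail a b c 1 q 0 / qpoch_inf (- a * q) q)"
    using H1_tail_0_sums[OF one q nz, of b c] by (simp add: mult.commute)
  from sums_unique[OF this, symmetric] u1_nz
  show "lim (H1_C a b c 1 q) = qpoch_inf (- a * q) q *
      (\<Sum>j. q ^ (j * (j + 1) div 2) * qpoch_hom b c q j / (qpoch q q j * qpoch (- a * q) q j))"
    using limI[OF H1_limits(1)[OF q]] by simp
  assume q0: "q \<noteq> 0"
  \<comment> \<open>Splitting off the first factor turns the denominators of index
    \<open>j + 1\<close> into those of \<open>H1_tail_1_sums\<close>.\<close>
  have split: "qpoch (- a * q) q (j + 1) = (1 + a * q) * qpoch (- a * q ^ 2) q j" for j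
    using qpoch_shift[of "- a * q" q 1 j] by (simp add: qpoch_def power2_eq_square mult_ac)
  have "(\<lambda>j. qpoch_hom b c q j * q ^ ((j + 1) * (j + 2) div 2) / (qpoch q q j * qpoch (- a * q ^ 2) q j))
      sums (q * H1_tail a b c 1 q 1 / u)"
    using H1_tail_1_sums[OF one q nz, of b c] by (simp add: u_def)
  from sums_divide[OF this, of "1 + a * q"]
  have "(\<lambda>j. q ^ ((j + 1) * (j + 2) div 2) * qpoch_hom b c q j / (qpoch q q j * qpoch (- a * q) q (j + 1)))
      sums (q * H1_tail a b c 1 q 1 / u / (1 + a * q))"
    unfolding split by (simp add: mult_ac)
  then have "(\<Sum>j. q ^ ((j + 1) * (j + 2) div 2) * qpoch_hom b c q j / (qpoch q q j * qpoch (- a * q) q (j + 1)))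
      = q * H1_tail a b c 1 q 1 / u / (1 + a * q)"
    by (rule sums_unique[symmetric])
  moreover have "(c / q - a * b) * ((1 + a * q) * u) * (q * t / u / (1 + a * q)) = (c - a * b * q) * t" for t
    using q0 u aq by (simp add: divide_simps)
  ultimately show "lim (H1_D a b c 1 q) = lim (H1_C a b c 1 q) +
      (c / q - a * b) * qpoch_inf (- a * q) q *
      (\<Sum>j. q ^ ((j + 1) * (j + 2) div 2) * qpoch_hom b c q j / (qpoch q q j * qpoch (- a * q) q (j + 1)))"
    unfolding limI[OF H1_limits(1)[OF q]] limI[OF H1_limits(2)[OF q]] u1 by (simp only:)
qed

theorem theorem2p3:
  fixes a b c d q :: complex
  assumes "d \<noteq> 0" and "norm q < 1"
  shows
    "(\<forall>N::nat. N \<ge> 1 \<longrightarrow>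
        H1_C a b c d q N =
          d ^ (N - 1) *
          (\<Sum>\<^sub>\<infinity>(j, l, n)\<in>(UNIV :: (nat \<times> nat \<times> nat) set).
             a ^ j * b powi (int n - int j - int l) * c ^ l * d powi (- int n - int l) *
             q ^ (n * (n + 1) div 2 + l * (l - 1) div 2) *
             gauss_binom q (int N - 1 - int n + int j) (int j) *
             gauss_binom q (int N - 1 - int j - int l) (int n - int j - int l) *
             gauss_binom q (int N - 1 - int n) (int l)))
     \<and>
     (\<forall>N::nat. N \<ge> 2 \<longrightarrow> q \<noteq> 0 \<longrightarrow> b \<noteq> 0 \<longrightarrow>
        H1_D a b c d q N = H1_C a b c d q N +
          (c / (b * q) - a) *
          (\<Sum>\<^sub>\<infinity>(j, l, n)\<in>(UNIV :: (nat \<times> nat \<times> nat) set).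
             a ^ j * b powi (int n + 1 - int j - int l) * c ^ l *
             d powi (int N - 2 - int n - int l) *
             q ^ ((n + 1) * (n + 2) div 2 + l * (l - 1) div 2) *
             gauss_binom q (int N - 2 - int n + int j) (int j) *
             gauss_binom q (int N - 2 - int j - int l) (int n - int j - int l) *
             gauss_binom q (int N - 2 - int n) (int l)))
     \<and>
     \<comment> \<open>the same with the factor \<open>b\<close> moved out of the sum, which also covers \<open>b = 0\<close>\<close>
     (\<forall>N::nat. N \<ge> 2 \<longrightarrow> q \<noteq> 0 \<longrightarrow>
        H1_D a b c d q N = H1_C a b c d q N +
          (c / q - a * b) *
          (\<Sum>\<^sub>\<infinity>(j, l, n)\<in>(UNIV :: (nat \<times> nat \<times> nat) set).
             a ^ j * b powi (int n - int j - int l) * c ^ l *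
             d powi (int N - 2 - int n - int l) *
             q ^ ((n + 1) * (n + 2) div 2 + l * (l - 1) div 2) *
             gauss_binom q (int N - 2 - int n + int j) (int j) *
             gauss_binom q (int N - 2 - int j - int l) (int n - int j - int l) *
             gauss_binom q (int N - 2 - int n) (int l)))
     \<and>
     ((\<exists>\<^sub>F N in sequentially. H1_C a b c d q N \<noteq> 0 \<or> H1_D a b c d q N \<noteq> 0) \<longrightarrow>
        (\<exists>h. H1_converges_to a b c d q h))
     \<and>
     (q \<noteq> 0 \<longrightarrow> (\<forall>k::nat. d + a * q ^ (k + 1) \<noteq> 0) \<longrightarrow>
        (let S1 = (\<Sum>j. qpoch_hom (b / d) (c / d ^ 2) q j * q ^ ((j + 1) * (j + 2) div 2) /
                        (qpoch q q j * qpoch (- a * q ^ 2 / d) q j));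
             S0 = (\<Sum>j. qpoch_hom (b / d) (c / d ^ 2) q j * q ^ (j * (j + 1) div 2) /
                        (qpoch q q j * qpoch (- a * q / d) q j))
         in
          (S0 \<noteq> 0 \<longrightarrow>
             (\<exists>h w. H1_converges_to a b c d q h \<and> sphere_inverse h = Some w \<and>
                    w - 1 = (c - a * b * q) / ((d + a * q) * q) * (S1 / S0))) \<and>
          \<comment> \<open>here both sides of the identity are infinite\<close>
          (S0 = 0 \<and> (c - a * b * q) * S1 \<noteq> 0 \<longrightarrow> H1_converges_to a b c d q (Some 0))))
     \<and>
     (d = 1 \<longrightarrow>
        convergent (H1_C a b c d q) \<and> convergent (H1_D a b c d q) \<and>
        ((\<forall>k::nat. 1 + a * q ^ (k + 1) \<noteq> 0) \<longrightarrow>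
           lim (H1_C a b c d q) =
             qpoch_inf (- a * q) q *
             (\<Sum>j. q ^ (j * (j + 1) div 2) * qpoch_hom b c q j /
                   (qpoch q q j * qpoch (- a * q) q j)) \<and>
           (q \<noteq> 0 \<longrightarrow>
             lim (H1_D a b c d q) = lim (H1_C a b c d q) +
               (c / q - a * b) * qpoch_inf (- a * q) q *
               (\<Sum>j. q ^ ((j + 1) * (j + 2) div 2) * qpoch_hom b c q j /
                     (qpoch q q j * qpoch (- a * q) q (j + 1))))))"
proof (intro conjI allI impI)
  show "convergent (H1_C a b c d q)" "convergent (H1_D a b c d q)" if "d = 1"
    using H1_limits[OF assms(2), of a b c] that by (auto simp: convergent_def)
next
  assume "q \<noteq> 0" "\<forall>k. d + a * q ^ (k + 1) \<noteq> 0"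
  then show "let S1 = (\<Sum>j. qpoch_hom (b / d) (c / d ^ 2) q j * q ^ ((j + 1) * (j + 2) div 2) /
                        (qpoch q q j * qpoch (- a * q ^ 2 / d) q j));
             S0 = (\<Sum>j. qpoch_hom (b / d) (c / d ^ 2) q j * q ^ (j * (j + 1) div 2) /
                        (qpoch q q j * qpoch (- a * q / d) q j))
         in
          (S0 \<noteq> 0 \<longrightarrow>
             (\<exists>h w. H1_converges_to a b c d q h \<and> sphere_inverse h = Some w \<and>
                    w - 1 = (c - a * b * q) / ((d + a * q) * q) * (S1 / S0))) \<and>
          (S0 = 0 \<and> (c - a * b * q) * S1 \<noteq> 0 \<longrightarrow> H1_converges_to a b c d q (Some 0))"
    unfolding Let_def by (intro conjI impI H1_inverse_value assms) auto
qed ((rule H1_C_sum_formula[OF assms] H1_D_sum_formula[OF assms(2)]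
      H1_D_sum_formula'[OF assms(2)] H1_converges[OF assms]; assumption)
    | (erule ssubst, rule H1_limit_values[OF assms(2)]; blast))+

end
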